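(* Let $A$ and $B$ be non-empty, bounded, open sets in $\mathbb{R}^d$, with $r=\operatorname{diam}(A\cup B)$. Let $1\le p\le\infty$, let $F:\mathbb{R}^d\to\mathbb{R}$ be in $L^p$ and supported on $A$, let $\epsilon>0$, let $\Phi:B\to A$ be an $\epsilon$-deformation, and define $F_\Phi(x)=F(\Phi(x))\,|\det(\nabla\Phi(x))|$ for $x\in B$ and $F_\Phi(x)=0$ elsewhere. Fix any probability distribution $\eta$ over $\mathbb{S}^{d-1}$. Then $$\mathrm{SV}_{p,\eta}(F,F_\Phi)\le\min\left\{\epsilon\cdot K_{p,\Phi}(F)\cdot C_{p,d}(r),\ \epsilon^{1/p}\cdot\|F\|_{L^1}\right\},$$ where $$K_{p,\Phi}(F)=\min\{\|F\|_{L^p},\|F_\Phi\|_{L^p}\},\qquad C_{p,d}(r)=2^{(p-1)/p}\,r^{(d-1)(p-1)/p}.$$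
   Context: $|\cdot|$ is the Euclidean norm. For $p=\infty$, $1/p=0$ and $(p-1)/p=1$; $\|F_\Phi\|_{L^p}$ may be $+\infty$. An $\epsilon$-deformation $\Phi:B\to A$ is a $C^1$ bijection of $B$ onto $A$ with $\det(\nabla\Phi(x))\ne0$ for all $x\in B$ and $|x-\Phi(x)|\le\epsilon$ for all $x\in B$. Tomographic projection onto the line spanned by a unit vector $w$: with $u_2,\dots,u_d$ an orthonormal basis of $w^\perp$, $$(\mathcal{P}_wF)(t)=\int_{\mathbb{R}^{d-1}}F(tw+s_1u_2+\dots+s_{d-1}u_d)\,ds_1\cdots ds_{d-1}.$$ Volterra $p$-norm: for an integrable function $h$ of one variable supported in $[a,b]$, $(\mathcal{V}h)(x)=\int_a^xh(t)\,dt$ and $\|h\|_{V^p}=\|\mathcal{V}h\|_{L^p([a,b])}$, where $[a,b]$ is any bounded interval containing the supports of the functions involved (since $\mathcal{P}_wF-\mathcal{P}_wF_\Phi$ has integral $0$, the value does not depend on the choice). Sliced Volterra distance: $$\mathrm{SV}_{p,\eta}(f,g)=\left(\int_{\mathbb{S}^{d-1}}\|\mathcal{P}_wf-\mathcal{P}_wg\|_{V^p}^p\,d\eta(w)\right)^{1/p},$$ interpreted for $p=\infty$ as the $\eta$-essential supremum of $\|\mathcal{P}_wf-\mathcal{P}_wg\|_{V^\infty}$ over $w\in\mathbb{S}^{d-1}$. *)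

theory Defs
  imports "HOL-Probability.Probability"
begin

text \<open>
  Exponents \<open>p\<close> range over the extended interval \<open>1 \<le> p \<le> \<infinity>\<close> and are rendered as extended
  nonnegative reals. The next two functions are \<open>1/p\<close> and \<open>(p-1)/p\<close>, with the conventions
  \<open>1/\<infinity> = 0\<close> and \<open>(\<infinity>-1)/\<infinity> = 1\<close>.
\<close>

definition recip_exponent :: "ennreal \<Rightarrow> real" where
  "recip_exponent p = (if p = \<infinity> then 0 else 1 / enn2real p)"

definition recip_conj_exponent :: "ennreal \<Rightarrow> real" where
  "recip_conj_exponent p = (if p = \<infinity> then 1 else (enn2real p - 1) / enn2real p)"

text \<open>Powers of extended nonnegative reals; only used for exponents \<open>r > 0\<close>.\<close>

definition ennpow :: "ennreal \<Rightarrow> real \<Rightarrow> ennreal" where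
  "ennpow x r = (if x = \<infinity> then \<infinity> else ennreal (enn2real x powr r))"

text \<open>
  The \<open>L\<^sup>p\<close> norm of a nonnegative function, possibly infinite. The norm of a real function \<open>f\<close>
  is obtained from \<open>\<bar>f\<bar>\<close>.
\<close>

definition Lp_ennorm :: "'a measure \<Rightarrow> ennreal \<Rightarrow> ('a \<Rightarrow> ennreal) \<Rightarrow> ennreal" where
  "Lp_ennorm M p f =
     (if p = \<infinity> then esssup M f
      else ennpow (\<integral>\<^sup>+x. ennpow (f x) (enn2real p) \<partial>M) (1 / enn2real p))"

definition Lp_norm :: "'a measure \<Rightarrow> ennreal \<Rightarrow> ('a \<Rightarrow> real) \<Rightarrow> ennreal" where
  "Lp_norm M p f = Lp_ennorm M p (\<lambda>x. ennreal \<bar>f x\<bar>)"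

definition in_Lp :: "'a measure \<Rightarrow> ennreal \<Rightarrow> ('a \<Rightarrow> real) \<Rightarrow> bool" where
  "in_Lp M p f \<longleftrightarrow> f \<in> borel_measurable M \<and> Lp_norm M p f < \<infinity>"

definition C1_on :: "(real ^ 'n \<Rightarrow> real ^ 'n) \<Rightarrow> (real ^ 'n) set \<Rightarrow> bool" where
  "C1_on \<Phi> S \<longleftrightarrow> (\<forall>x\<in>S. \<Phi> differentiable (at x)) \<and> continuous_on S (\<lambda>x. jacobian \<Phi> (at x))"

definition deformation ::
  "real \<Rightarrow> (real ^ 'n) set \<Rightarrow> (real ^ 'n) set \<Rightarrow> (real ^ 'n \<Rightarrow> real ^ 'n) \<Rightarrow> bool" where
  "deformation \<epsilon> B A \<Phi> \<longleftrightarrow>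
     C1_on \<Phi> B \<and> bij_betw \<Phi> B A \<and> (\<forall>x\<in>B. det (jacobian \<Phi> (at x)) \<noteq> 0) \<and>
     (\<forall>x\<in>B. norm (x - \<Phi> x) \<le> \<epsilon>)"

definition deformed ::
  "(real ^ 'n) set \<Rightarrow> (real ^ 'n \<Rightarrow> real ^ 'n) \<Rightarrow> (real ^ 'n \<Rightarrow> real) \<Rightarrow> real ^ 'n \<Rightarrow> real" where
  "deformed B \<Phi> F x = (if x \<in> B then F (\<Phi> x) * \<bar>det (jacobian \<Phi> (at x))\<bar> else 0)"

definition orthonormal_basis :: "'a::euclidean_space set \<Rightarrow> 'a set \<Rightarrow> bool" where
  "orthonormal_basis U S \<longleftrightarrow> pairwise orthogonal U \<and> (\<forall>u\<in>U. norm u = 1) \<and> span U = S"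

lemma orthonormal_basis_hyperplane_exists: "\<exists>U. orthonormal_basis U {v. w \<bullet> v = 0}"
  using orthonormal_basis_subspace[OF subspace_hyperplane[of w]]
  unfolding orthonormal_basis_def by metis

text \<open>
  The coordinates \<open>s\<close> are indexed by the basis vectors \<open>u \<in> U\<close> themselves, so the integral is
  over \<open>\<real>\<^sup>U\<close> with \<open>card U = d - 1\<close>. The product measure is completed since \<open>F\<close> is only
  assumed Lebesgue measurable. The value is independent of the basis chosen.
\<close>

definition tomographic_projection ::
  "'a::euclidean_space \<Rightarrow> ('a \<Rightarrow> real) \<Rightarrow> real \<Rightarrow> real" where
  "tomographic_projection w F t =
     (let U = (SOME U. orthonormal_basis U {v. w \<bullet> v = 0})
      in (LINT s | completion (\<Pi>\<^sub>M u\<in>U. lborel). F (t *\<^sub>R w + (\<Sum>u\<in>U. s u *\<^sub>R u))))"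

definition volterra :: "real \<Rightarrow> (real \<Rightarrow> real) \<Rightarrow> real \<Rightarrow> real" where
  "volterra a h x = (LINT t : {a..x} | lebesgue. h t)"

definition volterra_norm_on :: "real \<Rightarrow> real \<Rightarrow> ennreal \<Rightarrow> (real \<Rightarrow> real) \<Rightarrow> ennreal" where
  "volterra_norm_on a b p h = Lp_norm (lebesgue_on {a..b}) p (volterra a h)"

definition supporting_interval :: "(real \<Rightarrow> real) \<Rightarrow> real \<times> real \<Rightarrow> bool" where
  "supporting_interval h = (\<lambda>(a, b). a \<le> b \<and> (\<forall>t. t \<notin> {a..b} \<longrightarrow> h t = 0))"

text \<open>
  The interval is arbitrary among those supporting \<open>h\<close>; for \<open>h\<close> of integral \<open>0\<close> the value does
  not depend on it (lemma \<open>volterra_norm_eq\<close>).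
\<close>

definition volterra_norm :: "ennreal \<Rightarrow> (real \<Rightarrow> real) \<Rightarrow> ennreal" where
  "volterra_norm p h =
     (let (a, b) = (SOME I. supporting_interval h I) in volterra_norm_on a b p h)"

lemma volterra_eq:
  fixes h :: "real \<Rightarrow> real"
  assumes "\<And>t. t < a \<Longrightarrow> h t = 0"
  shows "volterra a h x = (LINT t : {..x} | lebesgue. h t)"
  unfolding volterra_def set_lebesgue_integral_def
  by (rule Bochner_Integration.integral_cong) (use assms in \<open>force simp: indicator_def\<close>)+

lemma volterra_outside:
  fixes h :: "real \<Rightarrow> real"
  assumes "\<And>t. t \<notin> {a..b} \<Longrightarrow> h t = 0" "(LINT t | lebesgue. h t) = 0" "x \<notin> {a..b}"
  shows "(LINT t : {..x} | lebesgue. h t) = 0"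
proof (cases "x < a")
  case True
  have "indicator {..x} t *\<^sub>R h t = 0" for t
    using assms(1)[of t] True by (cases "t \<in> {a..b}") (auto simp: indicator_def)
  then show ?thesis
    unfolding set_lebesgue_integral_def by (simp only: Bochner_Integration.integral_zero)
next
  case False
  then have "(LINT t : {..x} | lebesgue. h t) = (LINT t | lebesgue. h t)"
    unfolding set_lebesgue_integral_def
    by (intro Bochner_Integration.integral_cong)
      (use assms(1,3) in \<open>force simp: indicator_def\<close>)+
  then show ?thesis using assms(2) by simp
qed

lemma Lp_norm_lebesgue_on:
  fixes G :: "real \<Rightarrow> real"
  assumes S: "S \<in> sets lebesgue" and 0: "\<And>x. x \<notin> S \<Longrightarrow> G x = 0" and p: "1 \<le> p"
  shows "Lp_norm (lebesgue_on S) p G = Lp_norm lebesgue p G"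
proof (cases "p = \<infinity>")
  case False
  then have "0 < enn2real p"
    using p by (cases p) auto
  have "(\<integral>\<^sup>+x. ennpow (ennreal \<bar>G x\<bar>) (enn2real p) \<partial>lebesgue_on S)
      = (\<integral>\<^sup>+x. ennpow (ennreal \<bar>G x\<bar>) (enn2real p) * indicator S x \<partial>lebesgue)"
    using S by (intro nn_integral_restrict_space) simp
  also have "\<dots> = (\<integral>\<^sup>+x. ennpow (ennreal \<bar>G x\<bar>) (enn2real p) \<partial>lebesgue)"
    by (intro nn_integral_cong) (auto simp: indicator_def 0 ennpow_def)
  finally show ?thesis
    using False by (simp add: Lp_norm_def Lp_ennorm_def)
next
  case True
  define f where "f = (\<lambda>x. ennreal \<bar>G x\<bar>)"
  have eq: "(\<lambda>x. f x * indicator S x) = f"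
    by (auto simp: f_def indicator_def 0)
  have m: "f \<in> borel_measurable (lebesgue_on S) \<longleftrightarrow> f \<in> borel_measurable lebesgue"
    using borel_measurable_restrict_space_iff_ennreal[of S lebesgue f] S eq by simp
  have ae: "(AE x in lebesgue_on S. f x \<le> z) \<longleftrightarrow> (AE x in lebesgue. f x \<le> z)" for z
    using S by (subst AE_restrict_space_iff) (auto simp: f_def 0 intro!: AE_cong)
  have "esssup (lebesgue_on S) f = esssup lebesgue f"
  proof (cases "f \<in> borel_measurable lebesgue")
    case False
    then show ?thesis using m by (simp add: esssup_non_measurable)
  next
    case True
    then show ?thesis using m ae by (simp add: esssup_eq_AE)
  qed
  then show ?thesis
    using True by (simp add: Lp_norm_def Lp_ennorm_def f_def)
qed

lemma volterra_norm_on_eq: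
  assumes "supporting_interval h (a, b)" "(LINT t | lebesgue. h t) = 0" "1 \<le> p"
  shows "volterra_norm_on a b p h = Lp_norm lebesgue p (\<lambda>x. LINT t : {..x} | lebesgue. h t)"
proof -
  have s: "h t = 0" if "t \<notin> {a..b}" for t
    using assms(1) that unfolding supporting_interval_def by blast
  have "volterra a h = (\<lambda>x. LINT t : {..x} | lebesgue. h t)"
    by (intro ext volterra_eq s) auto
  moreover have "(LINT t : {..x} | lebesgue. h t) = 0" if "x \<notin> {a..b}" for x
    using s assms(2) that by (rule volterra_outside)
  ultimately show ?thesis
    unfolding volterra_norm_on_def using assms(3) by (simp only:) (rule Lp_norm_lebesgue_on, auto)
qed

lemma volterra_norm_eq:
  assumes "supporting_interval h (a, b)" "(LINT t | lebesgue. h t) = 0" "1 \<le> p"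
  shows "volterra_norm p h = volterra_norm_on a b p h"
proof -
  obtain c d where cd: "(SOME I. supporting_interval h I) = (c, d)"
    by fastforce
  have "supporting_interval h (c, d)"
    using someI[of "supporting_interval h", OF assms(1)] by (simp add: cd)
  then show ?thesis
    using assms by (simp add: volterra_norm_def cd volterra_norm_on_eq)
qed

definition sliced_volterra ::
  "ennreal \<Rightarrow> 'a::euclidean_space measure \<Rightarrow> ('a \<Rightarrow> real) \<Rightarrow> ('a \<Rightarrow> real) \<Rightarrow> ennreal" where
  "sliced_volterra p \<eta> f g =
     Lp_ennorm \<eta> p (\<lambda>w. volterra_norm p
       (\<lambda>t. tomographic_projection w f t - tomographic_projection w g t))"

definition K_const ::
  "ennreal \<Rightarrow> (real ^ 'n) set \<Rightarrow> (real ^ 'n \<Rightarrow> real ^ 'n) \<Rightarrow> (real ^ 'n \<Rightarrow> real) \<Rightarrow> ennreal" where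
  "K_const p B \<Phi> F = min (Lp_norm lebesgue p F) (Lp_norm lebesgue p (deformed B \<Phi> F))"

definition C_const :: "ennreal \<Rightarrow> nat \<Rightarrow> real \<Rightarrow> real" where
  "C_const p d r =
     2 powr recip_conj_exponent p * r powr (real (d - 1) * recip_conj_exponent p)"

end

theory Submission
  imports Defs
begin

text \<open>
  Fix a unit vector \<open>w\<close>. By Fubini in an orthonormal frame containing \<open>w\<close>, the Volterra primitive of the
  projection \<open>\<P>\<^sub>w F\<close> at height \<open>x\<close> is the integral of \<open>F\<close> over the half-space \<open>y \<bullet> w \<le> x\<close>. A change of
  variables turns the half-space integral of \<open>F\<^sub>\<Phi>\<close> into an integral of \<open>F\<close> over the points \<open>y\<close> with
  \<open>\<Phi>\<^sup>-\<^sup>1 y \<bullet> w \<le> x\<close>. So the difference of the two primitives at \<open>x\<close> is bounded by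
  \<open>g(x) = \<integral> \<bar>F(y)\<bar> \<chi>(x, y) dy\<close>, where \<open>\<chi>(x, y) = 1\<close> exactly if \<open>x\<close> separates \<open>y \<bullet> w\<close> from \<open>\<Phi>\<^sup>-\<^sup>1 y \<bullet> w\<close>.
  The set of these pairs is thin in both directions:

  \<^item> for fixed \<open>y\<close> the admissible \<open>x\<close> form an interval of length at most \<open>\<epsilon>\<close> (\<open>crossing_levels\<close>);
  \<^item> for fixed \<open>x\<close> the admissible \<open>y \<in> A\<close> lie in the slab \<open>\<bar>y \<bullet> w - x\<bar> \<le> \<epsilon>\<close>, and the part of that slab in
    a set of diameter \<open>r\<close> has volume at most \<open>m = 2 \<epsilon> r\<^bsup>d-1\<^esup>\<close> (\<open>emeasure_slab_le\<close>).

  Both estimates follow. Clearly \<open>g \<le> \<parallel>F\<parallel>\<^sub>1\<close>, and integrating over \<open>x\<close> first gives \<open>\<parallel>g\<parallel>\<^sub>1 \<le> \<epsilon> \<parallel>F\<parallel>\<^sub>1\<close>;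
  interpolation yields \<open>\<parallel>g\<parallel>\<^sub>p \<le> \<epsilon>\<^bsup>1/p\<^esup> \<parallel>F\<parallel>\<^sub>1\<close> (\<open>Lp_crossing_le_L1\<close>). Hoelder's inequality on the slab gives
  \<open>g(x)\<^sup>p \<le> m\<^bsup>p-1\<^esup> \<integral> \<bar>F(y)\<bar>\<^sup>p \<chi>(x, y) dy\<close>, and integrating over \<open>x\<close> gives
  \<open>\<parallel>g\<parallel>\<^sub>p\<^sup>p \<le> m\<^bsup>p-1\<^esup> \<epsilon> \<parallel>F\<parallel>\<^sub>p\<^sup>p\<close>, whose \<open>p\<close>-th root is the first bound (\<open>Lp_crossing_le_Lp\<close>). Changing
  variables in the other term instead exchanges the roles of \<open>F\<close> and \<open>F\<^sub>\<Phi>\<close>, which produces the minimum in the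
  constant \<open>K\<close> (\<open>Lp_norm_halfspace_deformed_le\<close>).

  All these bounds are uniform in \<open>w\<close>, so averaging over a probability measure preserves them. For
  \<open>p = \<infinity>\<close> the average is an essential supremum, which is infinite by convention on nonmeasurable functions; the
  measurability of the norm in \<open>w\<close> comes from the joint measurability of the half-space integrals in
  \<open>(w, x)\<close> (\<open>measurable_esssup\<close>, \<open>measurable_halfspace_integral\<close>).
\<close>

section \<open>Change of variables for an arbitrary finite index type\<close>

text \<open>
  The change-of-variables theorem and the volume formula for linear images concern coordinates indexed by a
  well-ordered finite type. This type is a well-ordered copy of a given finite type: renaming the coordinates
  along a bijection carries both results over to every finite index type.
\<close>

typedef (overloaded) ('n::finite) nat_index = "{..<CARD('n)}"
  morphisms nat_of_index index_of_nat
  by (rule exI[of _ 0]) simp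

instantiation nat_index :: (finite) wellorder
begin

definition less_eq_nat_index :: "'a nat_index \<Rightarrow> 'a nat_index \<Rightarrow> bool"
  where "less_eq_nat_index x y \<longleftrightarrow> nat_of_index x \<le> nat_of_index y"

definition less_nat_index :: "'a nat_index \<Rightarrow> 'a nat_index \<Rightarrow> bool"
  where "less_nat_index x y \<longleftrightarrow> nat_of_index x < nat_of_index y"

instance
proof
  fix P :: "'a nat_index \<Rightarrow> bool" and a
  assume step: "\<And>x. (\<And>y. y < x \<Longrightarrow> P y) \<Longrightarrow> P x"
  show "P a"
    by (induction a rule: measure_induct_rule[of nat_of_index])
      (rule step, simp add: less_nat_index_def)
next
  fix x y :: "'a nat_index"
  show "x = y" if "x \<le> y" "y \<le> x"
    using that by (simp add: less_eq_nat_index_def flip: nat_of_index_inject)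
qed (simp_all add: less_eq_nat_index_def less_nat_index_def less_le_not_le linear)

end

lemma bij_betw_nat_of_index: "bij_betw (nat_of_index :: 'n::finite nat_index \<Rightarrow> nat) UNIV {..<CARD('n)}"
  unfolding bij_betw_def inj_on_def
  by (metis nat_of_index_inject type_definition.Rep_range type_definition_nat_index)

instance nat_index :: (finite) finite
  by standard (use bij_betw_finite[OF bij_betw_nat_of_index] in simp)

lemma card_nat_index: "CARD('n nat_index) = CARD('n::finite)"
  using bij_betw_same_card[OF bij_betw_nat_of_index] by simp

lemma bij_nat_index_exists: "\<exists>\<sigma> :: 'n::finite \<Rightarrow> 'n nat_index. bij \<sigma>"
  by (rule finite_same_card_bij) (auto simp: card_nat_index)

definition permute_coords :: "('n::finite \<Rightarrow> 'm::finite) \<Rightarrow> real ^ 'm \<Rightarrow> real ^ 'n" where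
  "permute_coords \<sigma> x = (\<chi> i. x $ \<sigma> i)"

lemma permute_coords_nth [simp]: "permute_coords \<sigma> x $ i = x $ \<sigma> i"
  by (simp add: permute_coords_def)

lemma linear_permute_coords: "linear (permute_coords \<sigma>)"
  by (rule linearI) (auto simp: vec_eq_iff)

lemma permute_coords_inv:
  assumes "bij \<sigma>"
  shows "permute_coords (inv \<sigma>) (permute_coords \<sigma> x) = x"
    "permute_coords \<sigma> (permute_coords (inv \<sigma>) y) = y"
  using assms by (auto simp: vec_eq_iff bij_is_inj bij_is_surj surj_f_inv_f)

lemma inner_permute_coords:
  assumes "bij \<sigma>"
  shows "permute_coords \<sigma> x \<bullet> permute_coords \<sigma> y = x \<bullet> y"
  using sum.reindex_bij_betw[OF assms, of "\<lambda>i. x $ i \<bullet> y $ i"] by (simp add: inner_vec_def)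

lemma continuous_permute_coords: "continuous_on S (permute_coords \<sigma>)"
  by (simp add: linear_continuous_on[OF linear_permute_coords[of \<sigma>, unfolded linear_conv_bounded_linear]])

lemma measurable_permute_coords [measurable]: "permute_coords \<sigma> \<in> borel \<rightarrow>\<^sub>M borel"
  by (intro borel_measurable_continuous_onI continuous_permute_coords)

lemma prod_Basis_vec: "(\<Prod>b\<in>Basis. f ((x :: real ^ 'n::finite) \<bullet> b)) = (\<Prod>i\<in>UNIV. f (x $ i))"
proof -
  have B: "Basis = (\<lambda>i. axis i (1::real)) ` (UNIV :: 'n set)"
    by (auto simp: Basis_vec_def)
  have "inj (\<lambda>i :: 'n. axis i (1::real))"
    by (auto simp: inj_on_def axis_eq_axis)
  then show ?thesis
    unfolding B by (subst prod.reindex) (simp_all add: cart_eq_inner_axis)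
qed

text \<open>Renaming coordinates maps boxes to boxes with the same side lengths.\<close>

lemma distr_lborel_permute_coords:
  fixes \<sigma> :: "'n::finite \<Rightarrow> 'm::finite"
  assumes "bij \<sigma>"
  shows "distr lborel borel (permute_coords \<sigma>) = lborel"
proof (rule lborel_eqI[symmetric])
  fix l u :: "real ^ 'n"
  assume le: "\<And>b. b \<in> Basis \<Longrightarrow> l \<bullet> b \<le> u \<bullet> b"
  let ?l = "permute_coords (inv \<sigma>) l" and ?u = "permute_coords (inv \<sigma>) u"
  have le': "l $ i \<le> u $ i" for i
    using le[of "axis i 1"] by (simp add: cart_eq_inner_axis axis_in_Basis_iff)
  have "permute_coords \<sigma> -` box l u = box ?l ?u"
  proof (intro set_eqI)
    fix x
    have "(\<forall>i. l $ i < x $ \<sigma> i \<and> x $ \<sigma> i < u $ i)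
        \<longleftrightarrow> (\<forall>j. l $ inv \<sigma> j < x $ j \<and> x $ j < u $ inv \<sigma> j)"
      using assms by (metis bij_inv_eq_iff)
    then show "x \<in> permute_coords \<sigma> -` box l u \<longleftrightarrow> x \<in> box ?l ?u"
      by (simp add: mem_box_cart)
  qed
  then have "emeasure (distr lborel borel (permute_coords \<sigma>)) (box l u) = emeasure lborel (box ?l ?u)"
    by (simp add: emeasure_distr)
  also have "\<dots> = (\<Prod>b\<in>Basis. (?u - ?l) \<bullet> b)"
    by (rule emeasure_lborel_box) (auto simp: Basis_vec_def inner_axis le')
  also have "(\<Prod>b\<in>Basis. (?u - ?l) \<bullet> b) = (\<Prod>i\<in>UNIV. (u - l) $ inv \<sigma> i)"
    using prod_Basis_vec[of "\<lambda>t. t" "?u - ?l"] by simp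
  also have "\<dots> = (\<Prod>i\<in>UNIV. (u - l) $ i)"
    using assms by (intro prod.reindex_bij_betw bij_imp_bij_inv)
  also have "\<dots> = (\<Prod>b\<in>Basis. (u - l) \<bullet> b)"
    using prod_Basis_vec[of "\<lambda>t. t" "u - l"] by simp
  finally show "emeasure (distr lborel borel (permute_coords \<sigma>)) (box l u)
      = (\<Prod>b\<in>Basis. (u - l) \<bullet> b)" .
qed simp

text \<open>
  Conjugating by \<open>\<sigma>\<close> is a sign-preserving bijection between the permutations of the two index types, so it matches the
  two Leibniz expansions term by term.
\<close>

lemma det_permute_coords:
  fixes A :: "real ^ 'n::finite ^ 'n" and \<sigma> :: "'m::finite \<Rightarrow> 'n"
  assumes \<sigma>: "bij \<sigma>"
  shows "det (\<chi> i j. A $ \<sigma> i $ \<sigma> j) = det A"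
proof -
  have inj: "inj_on \<sigma> UNIV" and surj: "surj \<sigma>"
    using \<sigma> by (auto simp: bij_def)
  have mp: "map_permutation UNIV \<sigma> q (\<sigma> i) = \<sigma> (q i)" for q i
    using inj surj by (simp add: map_permutation_def restrict_id_def)
  have bij: "bij_betw (map_permutation UNIV \<sigma>) {q. q permutes UNIV} {q. q permutes UNIV}"
  proof (rule bij_betw_byWitness[where f' = "map_permutation UNIV (inv \<sigma>)"])
    show "map_permutation UNIV \<sigma> ` {q. q permutes UNIV} \<subseteq> {q. q permutes UNIV}"
      using map_permutation_permutes[of \<sigma> UNIV UNIV] \<sigma> by auto
    show "map_permutation UNIV (inv \<sigma>) ` {q. q permutes UNIV} \<subseteq> {q. q permutes UNIV}"
      using map_permutation_permutes[of "inv \<sigma>" UNIV UNIV] bij_imp_bij_inv[OF \<sigma>] by auto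
    show "\<forall>q\<in>{q. q permutes UNIV}. map_permutation UNIV (inv \<sigma>) (map_permutation UNIV \<sigma> q) = q"
      using map_permutation_compose[of \<sigma> UNIV UNIV "inv \<sigma>"] \<sigma> bij_imp_bij_inv[OF \<sigma>] inj
      by (auto simp: bij_is_inj)
    show "\<forall>q\<in>{q. q permutes UNIV}. map_permutation UNIV \<sigma> (map_permutation UNIV (inv \<sigma>) q) = q"
      using map_permutation_compose[of "inv \<sigma>" UNIV UNIV \<sigma>] \<sigma> bij_imp_bij_inv[OF \<sigma>] surj inj
      by (auto simp: surj_iff)
  qed
  have "det A = (\<Sum>q | q permutes UNIV. of_int (sign q) * (\<Prod>i\<in>UNIV. A $ i $ q i))"
    by (simp add: det_def)
  also have "\<dots> = (\<Sum>q | q permutes (UNIV :: 'm set).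
      of_int (sign (map_permutation UNIV \<sigma> q)) * (\<Prod>i\<in>UNIV. A $ i $ map_permutation UNIV \<sigma> q i))"
    by (rule sum.reindex_bij_betw[OF bij, symmetric])
  also have "\<dots> = (\<Sum>q | q permutes (UNIV :: 'm set).
      of_int (sign q) * (\<Prod>i\<in>UNIV. A $ \<sigma> i $ \<sigma> (q i)))"
  proof (rule sum.cong[OF refl])
    fix q :: "'m \<Rightarrow> 'm" assume "q \<in> {q. q permutes UNIV}"
    then have "sign (map_permutation UNIV \<sigma> q) = sign q"
      using inj by (intro sign_map_permutation) auto
    moreover have "(\<Prod>i\<in>UNIV. A $ i $ map_permutation UNIV \<sigma> q i)
        = (\<Prod>i\<in>UNIV. A $ \<sigma> i $ \<sigma> (q i))"
      using prod.reindex_bij_betw[OF \<sigma>, of "\<lambda>i. A $ i $ map_permutation UNIV \<sigma> q i"]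
      by (simp add: mp)
    ultimately show "of_int (sign (map_permutation UNIV \<sigma> q)) * (\<Prod>i\<in>UNIV. A $ i $ map_permutation UNIV \<sigma> q i)
      = of_int (sign q) * (\<Prod>i\<in>UNIV. A $ \<sigma> i $ \<sigma> (q i))"
      by simp
  qed
  also have "\<dots> = det (\<chi> i j. A $ \<sigma> i $ \<sigma> j)"
    by (simp add: det_def)
  finally show ?thesis by simp
qed

lemma
  fixes \<sigma> :: "'n::finite \<Rightarrow> 'm::finite"
  assumes \<sigma>: "bij \<sigma>"
  shows lebesgue_measurable_permute_coords: "permute_coords \<sigma> \<in> lebesgue \<rightarrow>\<^sub>M lebesgue"
    and distr_lebesgue_permute_coords: "distr lebesgue lebesgue (permute_coords \<sigma>) = lebesgue"
proof -
  have d: "distr lebesgue lborel (permute_coords \<sigma>) = (lborel :: (real ^ 'n) measure)"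
    by (subst distr_completion) (simp_all add: distr_lborel_permute_coords[OF \<sigma>] cong: distr_cong)
  show "permute_coords \<sigma> \<in> lebesgue \<rightarrow>\<^sub>M lebesgue"
    by (intro completion.measurable_completion2) (simp_all add: d measurable_completion)
  have "completion (distr lebesgue lborel (permute_coords \<sigma>)) = distr lebesgue lebesgue (permute_coords \<sigma>)"
    by (intro completion.completion_distr_eq) (simp_all add: d measurable_completion)
  then show "distr lebesgue lebesgue (permute_coords \<sigma>) = lebesgue"
    by (simp add: d)
qed

lemma
  fixes \<sigma> :: "'n::finite \<Rightarrow> 'm::finite" and f :: "real ^ 'n \<Rightarrow> real"
  assumes \<sigma>: "bij \<sigma>"
  shows integrable_permute_coords: "integrable lebesgue (\<lambda>x. f (permute_coords \<sigma> x)) \<longleftrightarrow> integrable lebesgue f"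
    and integral_permute_coords: "(LINT x | lebesgue. f (permute_coords \<sigma> x)) = (LINT y | lebesgue. f y)"
proof -
  note P = lebesgue_measurable_permute_coords[OF \<sigma>] distr_lebesgue_permute_coords[OF \<sigma>]
  note Q = lebesgue_measurable_permute_coords[OF bij_imp_bij_inv[OF \<sigma>]]
    distr_lebesgue_permute_coords[OF bij_imp_bij_inv[OF \<sigma>]]
  show iff: "integrable lebesgue (\<lambda>x. f (permute_coords \<sigma> x)) \<longleftrightarrow> integrable lebesgue f"
  proof
    assume "integrable lebesgue (\<lambda>x. f (permute_coords \<sigma> x))"
    then have "integrable lebesgue (\<lambda>y. f (permute_coords \<sigma> (permute_coords (inv \<sigma>) y)))"
      using integrable_distr[OF Q(1), of "\<lambda>x. f (permute_coords \<sigma> x)"] by (simp add: Q(2))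
    then show "integrable lebesgue f"
      by (simp add: permute_coords_inv[OF \<sigma>])
  next
    assume "integrable lebesgue f"
    then show "integrable lebesgue (\<lambda>x. f (permute_coords \<sigma> x))"
      using integrable_distr[OF P(1), of f] by (simp add: P(2))
  qed
  show "(LINT x | lebesgue. f (permute_coords \<sigma> x)) = (LINT y | lebesgue. f y)"
  proof (cases "integrable lebesgue f")
    case True
    then show ?thesis
      using integral_distr[OF P(1), of f] by (simp add: P(2))
  next
    case False
    then show ?thesis
      using iff by (simp add: not_integrable_integral_eq)
  qed
qed

text \<open>
  The equivalence of the pairs (integrability, value) is applied with one-dimensional vectors as values. When the
  integrands are not integrable, both Bochner integrals are \<open>0\<close>.
\<close>

lemma set_integral_change_of_variables_wellorder:
  fixes g :: "real ^ 'm::{finite, wellorder} \<Rightarrow> real ^ 'm::_" and f :: "real ^ 'm::_ \<Rightarrow> real"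
  assumes "S \<in> sets lebesgue"
    and "\<And>x. x \<in> S \<Longrightarrow> (g has_derivative g' x) (at x within S)"
    and "inj_on g S"
  shows "set_integrable lebesgue S (\<lambda>x. \<bar>det (matrix (g' x))\<bar> * f (g x)) \<longleftrightarrow> set_integrable lebesgue (g ` S) f"
    and "(LINT x : S | lebesgue. \<bar>det (matrix (g' x))\<bar> * f (g x)) = (LINT y : g ` S | lebesgue. f y)"
proof -
  let ?h = "\<lambda>x. \<bar>det (matrix (g' x))\<bar> * f (g x)"
  have "?h absolutely_integrable_on S \<and> integral S ?h = b \<longleftrightarrow>
      f absolutely_integrable_on (g ` S) \<and> integral (g ` S) f = b" for b
  proof -
    have "(\<lambda>x. \<bar>det (matrix (g' x))\<bar> *\<^sub>R vec (f (g x)) :: real ^ 1) absolutely_integrable_on S \<and>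
           integral S (\<lambda>x. \<bar>det (matrix (g' x))\<bar> *\<^sub>R vec (f (g x))) = (vec b :: real ^ 1)
         \<longleftrightarrow> (\<lambda>x. vec (f x) :: real ^ 1) absolutely_integrable_on (g ` S) \<and>
           integral (g ` S) (\<lambda>x. vec (f x)) = (vec b :: real ^ 1)"
      by (intro has_absolute_integral_change_of_variables assms)
    then show ?thesis
      by (simp add: absolutely_integrable_on_1_iff integral_on_1_eq)
  qed
  then have "?h absolutely_integrable_on S \<longleftrightarrow> f absolutely_integrable_on (g ` S)"
    and "?h absolutely_integrable_on S \<Longrightarrow> integral S ?h = integral (g ` S) f"
    by blast+
  moreover from this show "?h absolutely_integrable_on S \<longleftrightarrow> f absolutely_integrable_on (g ` S)"
    by blast
  ultimately show "(LINT x : S | lebesgue. ?h x) = (LINT y : g ` S | lebesgue. f y)"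
    by (cases "?h absolutely_integrable_on S")
      (simp_all add: set_lebesgue_integral_eq_integral set_integrable_def set_lebesgue_integral_def
        not_integrable_integral_eq flip: set_lebesgue_integral_eq_integral(2))
qed

text \<open>
  The map \<open>g\<close> is conjugated by a coordinate renaming \<open>P\<close>; the Jacobian matrix of the conjugated map at \<open>x\<close> is that of \<open>g\<close> at
  \<open>P x\<close> with rows and columns renamed, and \<open>P\<close> preserves Lebesgue measure.
\<close>

lemma
  fixes g :: "real ^ 'n::finite \<Rightarrow> real ^ 'n" and f :: "real ^ 'n \<Rightarrow> real"
  assumes S: "S \<in> sets lebesgue"
    and der: "\<And>x. x \<in> S \<Longrightarrow> (g has_derivative g' x) (at x within S)"
    and inj: "inj_on g S"
  shows set_integrable_change_of_variables:
      "set_integrable lebesgue S (\<lambda>x. \<bar>det (matrix (g' x))\<bar> * f (g x)) \<longleftrightarrow> set_integrable lebesgue (g ` S) f"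
    and set_integral_change_of_variables:
      "(LINT x : S | lebesgue. \<bar>det (matrix (g' x))\<bar> * f (g x)) = (LINT y : g ` S | lebesgue. f y)"
proof -
  obtain \<sigma> :: "'n \<Rightarrow> 'n nat_index" where \<sigma>: "bij \<sigma>"
    using bij_nat_index_exists by blast
  let ?P = "permute_coords \<sigma>" and ?Q = "permute_coords (inv \<sigma>)"
  note inv = permute_coords_inv[OF \<sigma>]
  define S' g1 g1' f1 where "S' = ?P -` S" and "g1 = ?Q \<circ> g \<circ> ?P"
    and "g1' = (\<lambda>x. ?Q \<circ> g' (?P x) \<circ> ?P)" and "f1 = f \<circ> ?P"
  have S': "S' \<in> sets lebesgue"
    using measurable_sets[OF lebesgue_measurable_permute_coords[OF \<sigma>] S] by (simp add: S'_def)
  have im: "?P ` S' \<subseteq> S"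
    by (auto simp: S'_def)
  have der': "(g1 has_derivative g1' x) (at x within S')" if "x \<in> S'" for x
    unfolding g1_def g1'_def
  proof (intro diff_chain_within)
    show "(?P has_derivative ?P) (at x within S')"
      by (intro linear_imp_has_derivative linear_permute_coords)
    show "(g has_derivative g' (?P x)) (at (?P x) within ?P ` S')"
      by (rule has_derivative_subset[OF der im]) (use that in \<open>simp add: S'_def\<close>)
    show "(?Q has_derivative ?Q) (at (g (?P x)) within g ` ?P ` S')"
      by (intro linear_imp_has_derivative linear_permute_coords)
  qed
  have inj': "inj_on g1 S'"
    by (rule inj_onI, unfold g1_def S'_def) (metis comp_apply inv inj inj_onD vimageE)
  have det: "det (matrix (g1' x)) = det (matrix (g' (?P x)))" for x
  proof -
    have ax: "?P (axis j 1) = axis (inv \<sigma> j) 1" for j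
      using \<sigma> by (auto simp: vec_eq_iff axis_def bij_is_surj surj_f_inv_f bij_is_inj)
    have "matrix (g1' x) = (\<chi> i j. matrix (g' (?P x)) $ inv \<sigma> i $ inv \<sigma> j)"
      by (simp add: matrix_def vec_eq_iff g1'_def ax)
    then show ?thesis
      by (simp add: det_permute_coords[OF bij_imp_bij_inv[OF \<sigma>]])
  qed
  have img: "x \<in> g1 ` S' \<longleftrightarrow> ?P x \<in> g ` S" for x
  proof
    assume "?P x \<in> g ` S"
    then obtain y where "y \<in> S" "?P x = g y" by blast
    then have "?Q y \<in> S'" "g1 (?Q y) = x"
      by (simp_all add: S'_def g1_def inv) (metis inv)
    then show "x \<in> g1 ` S'" by blast
  qed (auto simp: g1_def S'_def inv)
  have lhs: "indicator S' x *\<^sub>R (\<bar>det (matrix (g1' x))\<bar> * f1 (g1 x))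
      = (\<lambda>y. indicator S y *\<^sub>R (\<bar>det (matrix (g' y))\<bar> * f (g y))) (?P x)" for x
    by (simp add: det f1_def g1_def S'_def inv indicator_def)
  have rhs: "indicator (g1 ` S') x *\<^sub>R f1 x = (\<lambda>y. indicator (g ` S) y *\<^sub>R f y) (?P x)" for x
    using img by (simp add: f1_def indicator_def)
  note cov = set_integral_change_of_variables_wellorder[OF S' der' inj', of f1]
  show "set_integrable lebesgue S (\<lambda>x. \<bar>det (matrix (g' x))\<bar> * f (g x)) \<longleftrightarrow> set_integrable lebesgue (g ` S) f"
    using cov(1) integrable_permute_coords[OF \<sigma>, of "\<lambda>y. indicator S y *\<^sub>R (\<bar>det (matrix (g' y))\<bar> * f (g y))"]
      integrable_permute_coords[OF \<sigma>, of "\<lambda>y. indicator (g ` S) y *\<^sub>R f y"]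
    unfolding set_integrable_def lhs rhs by blast
  show "(LINT x : S | lebesgue. \<bar>det (matrix (g' x))\<bar> * f (g x)) = (LINT y : g ` S | lebesgue. f y)"
    using cov(2) integral_permute_coords[OF \<sigma>, of "\<lambda>y. indicator S y *\<^sub>R (\<bar>det (matrix (g' y))\<bar> * f (g y))"]
      integral_permute_coords[OF \<sigma>, of "\<lambda>y. indicator (g ` S) y *\<^sub>R f y"]
    unfolding set_lebesgue_integral_def lhs rhs by simp
qed

section \<open>Lebesgue measure in an orthonormal frame\<close>

lemma distr_lborel_orthogonal_wellorder:
  fixes R :: "real ^ 'm::{finite, wellorder} \<Rightarrow> real ^ 'm::_"
  assumes R: "orthogonal_transformation R"
  shows "distr lborel borel R = lborel"
proof (rule lborel_eqI[symmetric])
  fix l u :: "real ^ 'm::_"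
  assume le: "\<And>b. b \<in> Basis \<Longrightarrow> l \<bullet> b \<le> u \<bullet> b"
  have Rb [measurable]: "R \<in> borel \<rightarrow>\<^sub>M borel"
    using R by (intro borel_measurable_continuous_onI linear_continuous_on)
      (simp add: orthogonal_transformation_linear linear_conv_bounded_linear[symmetric])
  have inv: "orthogonal_transformation (inv R)"
    by (rule orthogonal_transformation_inv[OF R])
  have eq: "R -` box l u = inv R ` box l u"
    using orthogonal_transformation_bij[OF R] by (simp add: bij_vimage_eq_inv_image)
  have "\<bar>det (matrix (inv R))\<bar> = 1"
    using inv by (simp add: orthogonal_transformation_det)
  then have "measure lebesgue (inv R ` box l u) = measure lebesgue (box l u)"
    and "inv R ` box l u \<in> lmeasurable"
    using measure_linear_image[OF orthogonal_transformation_linear[OF inv], of "box l u"]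
      measurable_linear_image[OF orthogonal_transformation_linear[OF inv], of "box l u"] by simp_all
  then have "emeasure lebesgue (R -` box l u) = emeasure lebesgue (box l u)"
    unfolding eq by (simp add: emeasure_eq_measure2 lmeasurable_box)
  moreover have "R -` box l u \<in> sets borel"
    using measurable_sets[OF Rb, of "box l u"] by simp
  ultimately have "emeasure lborel (R -` box l u) = emeasure lborel (box l u)"
    by simp
  then show "emeasure (distr lborel borel R) (box l u) = (\<Prod>b\<in>Basis. (u - l) \<bullet> b)"
    using le by (simp add: emeasure_distr emeasure_lborel_box)
qed simp

lemma distr_lborel_orthogonal:
  fixes R :: "real ^ 'n::finite \<Rightarrow> real ^ 'n"
  assumes R: "orthogonal_transformation R"
  shows "distr lborel borel R = lborel"
proof -
  obtain \<sigma> :: "'n \<Rightarrow> 'n nat_index" where \<sigma>: "bij \<sigma>"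
    using bij_nat_index_exists by blast
  let ?P = "permute_coords \<sigma>" and ?Q = "permute_coords (inv \<sigma>)"
  note inv = permute_coords_inv[OF \<sigma>]
  have Rb [measurable]: "R \<in> borel \<rightarrow>\<^sub>M borel"
    using R by (intro borel_measurable_continuous_onI linear_continuous_on)
      (simp add: orthogonal_transformation_linear linear_conv_bounded_linear[symmetric])
  have "orthogonal_transformation (?Q \<circ> R \<circ> ?P)"
    using R unfolding orthogonal_transformation_def
    by (auto simp: inner_permute_coords[OF \<sigma>] inner_permute_coords[OF bij_imp_bij_inv[OF \<sigma>]]
        intro!: linear_compose linear_permute_coords)
  then have 1: "distr lborel borel (?Q \<circ> R \<circ> ?P) = lborel"
    by (rule distr_lborel_orthogonal_wellorder)
  have "distr lborel borel R = distr (distr lborel borel ?P) borel R"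
    by (simp add: distr_lborel_permute_coords[OF \<sigma>])
  also have "\<dots> = distr lborel borel (?P \<circ> (?Q \<circ> R \<circ> ?P))"
    by (subst distr_distr) (simp_all add: comp_def inv)
  also have "\<dots> = distr (distr lborel borel (?Q \<circ> R \<circ> ?P)) borel ?P"
    by (subst distr_distr) simp_all
  also have "\<dots> = lborel"
    by (simp add: 1 distr_lborel_permute_coords[OF \<sigma>])
  finally show ?thesis .
qed

lemma orthonormal_basis_hyperplane:
  fixes w :: "'a::euclidean_space"
  assumes w: "norm w = 1" and U: "orthonormal_basis U {v. w \<bullet> v = 0}"
  shows "finite U" "w \<notin> U" "card U = DIM('a) - 1"
    "\<And>u v. u \<in> insert w U \<Longrightarrow> v \<in> insert w U \<Longrightarrow> u \<bullet> v = (if u = v then 1 else 0)"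
proof -
  have U1: "norm u = 1" if "u \<in> U" for u
    using U that by (auto simp: orthonormal_basis_def)
  have perp: "w \<bullet> u = 0" if "u \<in> U" for u
    using U span_base[OF that] by (auto simp: orthonormal_basis_def)
  have pw: "pairwise orthogonal U"
    using U by (simp add: orthonormal_basis_def)
  have "0 \<notin> U"
    using U1 by force
  with pw have indep: "independent U"
    by (rule pairwise_orthogonal_independent)
  then show fin: "finite U"
    by (rule independent_imp_finite)
  show "w \<notin> U"
    using perp[of w] w by auto
  have "card U = dim (span U)"
    using indep by (simp add: dim_eq_card_independent)
  also have "span U = {v. w \<bullet> v = 0}"
    using U by (simp add: orthonormal_basis_def)
  also have "dim \<dots> = DIM('a) - 1"
    using w by (intro dim_hyperplane) auto
  finally show "card U = DIM('a) - 1" .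
  show "u \<bullet> v = (if u = v then 1 else 0)" if "u \<in> insert w U" "v \<in> insert w U" for u v
  proof (cases "u = v")
    case True
    then show ?thesis
      using that w U1 by (auto simp: norm_eq_1)
  next
    case False
    then show ?thesis
      using that perp pairwiseD[OF pw, of u v] by (auto simp: orthogonal_def inner_commute)
  qed
qed

text \<open>The point with coordinate \<open>t\<close> along \<open>w\<close> and coordinates \<open>s\<close> in the basis \<open>U\<close> of the hyperplane orthogonal to \<open>w\<close>.\<close>

definition frame_point :: "'a::euclidean_space \<Rightarrow> 'a set \<Rightarrow> real \<times> ('a \<Rightarrow> real) \<Rightarrow> 'a" where
  "frame_point w U = (\<lambda>(t, s). t *\<^sub>R w + (\<Sum>u\<in>U. s u *\<^sub>R u))"

lemma measurable_frame_point [measurable]: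
  "frame_point w U \<in> borel_measurable (lborel \<Otimes>\<^sub>M (\<Pi>\<^sub>M u\<in>U. lborel))"
  unfolding frame_point_def by measurable

lemma frame_point_inner:
  assumes "norm w = 1" "orthonormal_basis U {v. w \<bullet> v = 0}"
  shows "frame_point w U (t, s) \<bullet> w = t" "u \<in> U \<Longrightarrow> frame_point w U (t, s) \<bullet> u = s u"
proof -
  note B = orthonormal_basis_hyperplane[OF assms]
  have "(\<Sum>v\<in>U. s v * (v \<bullet> w)) = 0"
    using B(2) B(4)[of _ w] by (intro sum.neutral) auto
  then show "frame_point w U (t, s) \<bullet> w = t"
    using B(4)[of w w] by (simp add: frame_point_def inner_add_left inner_sum_left)
  assume u: "u \<in> U"
  have "(\<Sum>v\<in>U. s v * (v \<bullet> u)) = (\<Sum>v\<in>U. if v = u then s u else 0)"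
    using u B(4)[of _ u] by (intro sum.cong) auto
  also have "\<dots> = s u"
    using u B(1) by simp
  finally show "frame_point w U (t, s) \<bullet> u = s u"
    using u B(2) B(4)[of w u] by (auto simp: frame_point_def inner_add_left inner_sum_left)
qed

text \<open>
  Up to the orthogonal map \<open>R\<close> that sends the standard basis to the frame, frame coordinates are the standard
  coordinates, for which the preimage of a box is a product of intervals.
\<close>

lemma lborel_frame:
  fixes w :: "real ^ 'n::finite"
  assumes w: "norm w = 1" and U: "orthonormal_basis U {v. w \<bullet> v = 0}"
  shows "distr (lborel \<Otimes>\<^sub>M (\<Pi>\<^sub>M u\<in>U. lborel)) borel (frame_point w U) = lborel"
proof -
  note B = orthonormal_basis_hyperplane[OF w U]
  interpret product_sigma_finite "\<lambda>u :: real ^ 'n. lborel :: real measure" ..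
  interpret PU: sigma_finite_measure "\<Pi>\<^sub>M u\<in>U. (lborel :: real measure)"
    using sigma_finite[OF B(1)] .
  let ?M = "lborel \<Otimes>\<^sub>M (\<Pi>\<^sub>M u\<in>U. (lborel :: real measure))"
  have "card (Basis :: (real ^ 'n) set) = card (insert w U)"
    using B(1,2,3) by simp
  then obtain c where c: "bij_betw c (Basis :: (real ^ 'n) set) (insert w U)"
    using B(1) by (metis finite_Basis finite_insert finite_same_card_bij)
  define c' where "c' = inv_into Basis c"
  have c': "bij_betw c' (insert w U) Basis"
    unfolding c'_def by (rule bij_betw_inv_into[OF c])
  have c'c: "c' (c b) = b" if "b \<in> Basis" for b
    unfolding c'_def using c that by (simp add: bij_betw_inv_into_left)
  have cc': "c (c' v) = v" if "v \<in> insert w U" for v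
    unfolding c'_def using bij_betw_inv_into_right[OF c that] .
  have c'B: "c' v \<in> Basis" if "v \<in> insert w U" for v
    using c' that by (auto simp: bij_betw_def)
  \<comment> \<open>\<open>R\<close> sends the standard basis vector \<open>b\<close> to the frame vector \<open>c b\<close>, and \<open>T\<close> below is the frame map before this rotation\<close>
  define R where "R = (\<lambda>y :: real ^ 'n. \<Sum>b\<in>Basis. (y \<bullet> b) *\<^sub>R c b)"
  have linR: "linear R"
    unfolding R_def by (rule linearI)
      (simp_all add: inner_add_left scaleR_add_left sum.distrib scaleR_sum_right)
  have Rc': "R (c' v) = v" if "v \<in> insert w U" for v
  proof -
    have "R (c' v) = (\<Sum>b\<in>Basis. (if b = c' v then v else 0))"
      unfolding R_def using c'B[OF that] cc'[OF that] by (intro sum.cong) (auto simp: inner_Basis)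
    then show ?thesis
      using c'B[OF that] by simp
  qed
  have R: "orthogonal_transformation R"
    unfolding orthogonal_transformation_def
  proof (intro conjI allI linR)
    fix x y
    have "R x \<bullet> R y = (\<Sum>a\<in>Basis. \<Sum>b\<in>Basis. (x \<bullet> a) * ((y \<bullet> b) * (c a \<bullet> c b)))"
      unfolding R_def by (simp add: inner_sum_left inner_sum_right sum_distrib_left)
        (subst sum.swap, simp add: mult.left_commute)
    also have "\<dots> = (\<Sum>a\<in>Basis. \<Sum>b\<in>Basis. if b = a then (x \<bullet> a) * (y \<bullet> a) else 0)"
    proof (intro sum.cong refl)
      fix a b :: "real ^ 'n" assume ab: "a \<in> Basis" "b \<in> Basis"
      have "c a \<bullet> c b = (if c a = c b then 1 else 0)"
        using ab c by (intro B(4)) (auto simp: bij_betw_def)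
      also have "c a = c b \<longleftrightarrow> b = a"
        using ab c'c by metis
      finally show "(x \<bullet> a) * ((y \<bullet> b) * (c a \<bullet> c b)) = (if b = a then (x \<bullet> a) * (y \<bullet> a) else 0)"
        by simp
    qed
    also have "\<dots> = (\<Sum>a\<in>Basis. (x \<bullet> a) * (y \<bullet> a))"
      by simp
    also have "\<dots> = x \<bullet> y"
      by (rule euclidean_inner[symmetric])
    finally show "R x \<bullet> R y = x \<bullet> y" .
  qed
  define T where "T = (\<lambda>(t, s). t *\<^sub>R c' w + (\<Sum>u\<in>U. s u *\<^sub>R c' u))"
  have T [measurable]: "T \<in> borel_measurable ?M"
    unfolding T_def by measurable
  have Tw: "T (t, s) \<bullet> c' w = t" for t s
  proof -
    have "(\<Sum>u\<in>U. s u * (c' u \<bullet> c' w)) = 0"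
      using B(2) c'B cc' by (intro sum.neutral) (auto simp: inner_Basis, metis insertCI)
    then show ?thesis
      using c'B[of w] by (simp add: T_def inner_add_left inner_sum_left)
  qed
  have Tu: "T (t, s) \<bullet> c' u = s u" if "u \<in> U" for t s u
  proof -
    have ne: "c' v \<noteq> c' u" if "v \<in> insert w U" "v \<noteq> u" for v
      using that \<open>u \<in> U\<close> cc' by (metis insertCI)
    have "(\<Sum>v\<in>U. s v * (c' v \<bullet> c' u)) = (\<Sum>v\<in>U. if v = u then s u else 0)"
      using that c'B ne by (intro sum.cong) (auto simp: inner_Basis)
    moreover have "c' w \<bullet> c' u = 0"
      using that ne[of w] B(2) c'B by (auto simp: inner_Basis)
    ultimately show ?thesis
      using that B(1) by (simp add: T_def inner_add_left inner_sum_left)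
  qed
  have eq: "distr ?M borel T = lborel"
  proof (rule lborel_eqI[symmetric])
    fix l u :: "real ^ 'n"
    assume le: "\<And>b. b \<in> Basis \<Longrightarrow> l \<bullet> b \<le> u \<bullet> b"
    have Bas: "Basis = c' ` insert w U"
      using c' by (auto simp: bij_betw_def)
    have "T -` box l u \<inter> space ?M
        = {l \<bullet> c' w <..< u \<bullet> c' w} \<times> (\<Pi>\<^sub>E v\<in>U. {l \<bullet> c' v <..< u \<bullet> c' v})"
      by (auto simp: mem_box Bas Tw Tu space_pair_measure space_PiM PiE_iff)
    then have "emeasure (distr ?M borel T) (box l u)
        = emeasure ?M ({l \<bullet> c' w <..< u \<bullet> c' w} \<times> (\<Pi>\<^sub>E v\<in>U. {l \<bullet> c' v <..< u \<bullet> c' v}))"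
      by (simp add: emeasure_distr)
    also have "\<dots> = ennreal ((u - l) \<bullet> c' w) * (\<Prod>v\<in>U. ennreal ((u - l) \<bullet> c' v))"
      using le c'B B(1)
      by (subst PU.emeasure_pair_measure_Times) (auto simp: emeasure_PiM sets_PiM_I_finite inner_diff_left intro!: prod.cong)
    also have "\<dots> = (\<Prod>v\<in>insert w U. ennreal ((u - l) \<bullet> c' v))"
      using B(1,2) by simp
    also have "\<dots> = (\<Prod>b\<in>Basis. ennreal ((u - l) \<bullet> b))"
      by (rule prod.reindex_bij_betw[OF c'])
    also have "\<dots> = ennreal (\<Prod>b\<in>Basis. (u - l) \<bullet> b)"
      using le by (intro prod_ennreal) (simp add: inner_diff_left)
    finally show "emeasure (distr ?M borel T) (box l u) = (\<Prod>b\<in>Basis. (u - l) \<bullet> b)" .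
  qed simp
  have "frame_point w U = R \<circ> T"
    using linR Rc' by (auto simp: fun_eq_iff frame_point_def T_def linear_add linear_scale linear_sum)
  moreover have "R \<in> borel \<rightarrow>\<^sub>M borel"
    using linR by (intro borel_measurable_continuous_onI linear_continuous_on)
      (simp add: linear_conv_bounded_linear[symmetric])
  ultimately have "distr ?M borel (frame_point w U) = distr (distr ?M borel T) borel R"
    by (simp add: distr_distr)
  then show ?thesis
    by (simp add: eq distr_lborel_orthogonal[OF R])
qed

section \<open>Primitives of tomographic projections\<close>

text \<open>
  A Lebesgue measurable function is handled through a Borel function that agrees with it almost everywhere. The next
  two lemmas move measurability and integrals between the two.
\<close>

lemma measurable_completion_AE_eq:
  assumes g: "g \<in> M \<rightarrow>\<^sub>M N" and ae: "AE x in M. f x = g x" and f: "\<And>x. x \<in> space M \<Longrightarrow> f x \<in> space N"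
  shows "f \<in> completion M \<rightarrow>\<^sub>M N"
proof (rule measurableI)
  fix S assume S: "S \<in> sets N"
  have 1: "{x \<in> space (completion M). f x \<noteq> g x} \<in> sets (completion M)"
    using ae sets_completion_AE[where M = M and P = "\<lambda>x. f x \<noteq> g x"] unfolding pred_def by simp
  have 2: "{x \<in> space (completion M). f x \<in> S \<and> f x \<noteq> g x} \<in> sets (completion M)"
  proof -
    have "AE x in M. \<not> (f x \<in> S \<and> f x \<noteq> g x)"
      using ae by (rule eventually_mono) simp
    then show ?thesis
      using sets_completion_AE[where M = M and P = "\<lambda>x. f x \<in> S \<and> f x \<noteq> g x"] unfolding pred_def
      by blast
  qed
  have 3: "g -` S \<inter> space (completion M) \<in> sets (completion M)"
    using measurable_sets[OF g S] by simp
  have "f -` S \<inter> space (completion M)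
      = (g -` S \<inter> space (completion M) - {x \<in> space (completion M). f x \<noteq> g x})
        \<union> {x \<in> space (completion M). f x \<in> S \<and> f x \<noteq> g x}"
    by auto
  also have "\<dots> \<in> sets (completion M)"
    using 1 2 3 by (intro sets.Un sets.Diff)
  finally show "f -` S \<inter> space (completion M) \<in> sets (completion M)" .
qed (simp add: f)

lemma integral_completion_AE_eq:
  fixes f g :: "'a \<Rightarrow> 'b::{banach, second_countable_topology}"
  assumes "g \<in> borel_measurable M" "AE x in M. f x = g x"
  shows "integral\<^sup>L (completion M) f = integral\<^sup>L M g"
    "integrable (completion M) f \<longleftrightarrow> integrable M g"
proof -
  have f: "f \<in> borel_measurable (completion M)"
    using assms by (rule measurable_completion_AE_eq) simp
  have "integral\<^sup>L (completion M) f = integral\<^sup>L (completion M) g"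
    using assms by (intro integral_cong_AE f measurable_completion AE_completion)
  then show "integral\<^sup>L (completion M) f = integral\<^sup>L M g"
    using assms(1) by (simp add: integral_completion)
  have "integrable (completion M) f \<longleftrightarrow> integrable (completion M) g"
    using assms by (intro integrable_cong_AE f measurable_completion AE_completion)
  then show "integrable (completion M) f \<longleftrightarrow> integrable M g"
    using assms(1) by (simp add: integrable_completion)
qed

text \<open>
  The factor \<open>k (y \<bullet> w)\<close> is constant on each hyperplane of integration, so Fubini in frame coordinates moves it past the
  inner integral. With \<open>k = 1\<close> this is conservation of mass, and with \<open>k\<close> the indicator of a half-line it computes the primitive of the
  projection. For a Lebesgue measurable \<open>F\<close> the identity of the inner integrals holds for almost every \<open>t\<close>,
  since almost every slice of a null set is null.
\<close>

lemma tomographic_projection_Fubini: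
  fixes w :: "real ^ 'n::finite" and F :: "real ^ 'n \<Rightarrow> real" and k :: "real \<Rightarrow> real"
  assumes w: "norm w = 1" and F: "integrable lebesgue F"
    and k [measurable]: "k \<in> borel_measurable borel" and k1: "\<And>t. \<bar>k t\<bar> \<le> 1"
  shows "integrable lebesgue (\<lambda>t. k t * tomographic_projection w F t)"
    and "(LINT t | lebesgue. k t * tomographic_projection w F t) = (LINT y | lebesgue. k (y \<bullet> w) * F y)"
proof -
  define U where "U = (SOME U. orthonormal_basis U {v. w \<bullet> v = 0})"
  have U: "orthonormal_basis U {v. w \<bullet> v = 0}"
    unfolding U_def using orthonormal_basis_hyperplane_exists by (rule someI_ex)
  note B = orthonormal_basis_hyperplane[OF w U]
  interpret product_sigma_finite "\<lambda>u :: real ^ 'n. lborel :: real measure" ..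
  let ?P = "\<Pi>\<^sub>M u\<in>U. (lborel :: real measure)"
  interpret PU: sigma_finite_measure ?P
    using sigma_finite[OF B(1)] .
  interpret pair_sigma_finite "lborel :: real measure" ?P ..
  let ?T = "frame_point w U"
  obtain F' where F' [measurable]: "F' \<in> borel_measurable lborel" and ae: "AE y in lborel. F y = F' y"
    using completion_ex_borel_measurable_real[OF borel_measurable_integrable[OF F]] by blast
  have int': "integrable lborel F'"
    using integral_completion_AE_eq(2)[OF F' ae] F by simp
  have intk: "integrable lborel (\<lambda>y. k (y \<bullet> w) * F' y)"
  proof (rule Bochner_Integration.integrable_bound[OF int'])
    show "AE y in lborel. norm (k (y \<bullet> w) * F' y) \<le> norm (F' y)"
      using k1 by (auto simp: abs_mult mult_left_le_one_le)
  qed measurable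
  have T_k: "k (?T (t, s) \<bullet> w) * F' (?T (t, s)) = k t * F' (?T (t, s))" for t s
    by (simp add: frame_point_inner[OF w U])
  define G where "G = (\<lambda>z. k (?T z \<bullet> w) * F' (?T z))"
  have intG: "integrable (lborel \<Otimes>\<^sub>M ?P) G"
    and G_eq: "integral\<^sup>L (lborel \<Otimes>\<^sub>M ?P) G = (LINT y | lborel. k (y \<bullet> w) * F' y)"
  proof -
    have "integrable (distr (lborel \<Otimes>\<^sub>M ?P) borel ?T) (\<lambda>y. k (y \<bullet> w) * F' y)"
      using intk by (simp add: lborel_frame[OF w U])
    then show "integrable (lborel \<Otimes>\<^sub>M ?P) G"
      unfolding G_def by (subst (asm) integrable_distr_eq) auto
    show "integral\<^sup>L (lborel \<Otimes>\<^sub>M ?P) G = (LINT y | lborel. k (y \<bullet> w) * F' y)"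
      unfolding G_def by (subst lborel_frame[OF w U, symmetric], subst integral_distr) auto
  qed
  define p where "p = (\<lambda>t. LINT s | ?P. F' (?T (t, s)))"
  have G_fst: "(LINT s | ?P. G (t, s)) = k t * p t" for t
    unfolding G_def T_k p_def by simp
  have intp: "integrable lborel (\<lambda>t. k t * p t)"
    using integrable_fst'[OF intG] by (simp add: G_fst)
  have p_eq: "(LINT t | lborel. k t * p t) = (LINT y | lborel. k (y \<bullet> w) * F' y)"
    using integral_fst'[OF intG] by (simp add: G_fst G_eq)
  have "AE z in lborel \<Otimes>\<^sub>M ?P. F (?T z) = F' (?T z)"
    by (rule AE_distrD[where M' = borel and f = ?T and P = "\<lambda>y. F y = F' y"])
      (unfold lborel_frame[OF w U], use ae in simp_all)
  then have "AE t in lborel. AE s in ?P. F (?T (t, s)) = F' (?T (t, s))"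
    by (rule AE_pair)
  then have "AE t in lborel. tomographic_projection w F t = p t"
  proof (rule eventually_mono)
    fix t assume ae: "AE s in ?P. F (?T (t, s)) = F' (?T (t, s))"
    have "tomographic_projection w F t = (LINT s | completion ?P. F (?T (t, s)))"
      by (simp add: tomographic_projection_def Let_def frame_point_def flip: U_def)
    also have "\<dots> = p t"
      unfolding p_def by (rule integral_completion_AE_eq(1)[OF _ ae]) measurable
    finally show "tomographic_projection w F t = p t" .
  qed
  then have ae': "AE t in lborel. k t * tomographic_projection w F t = k t * p t"
    by (rule eventually_mono) simp
  have pm: "(\<lambda>t. k t * p t) \<in> borel_measurable lborel"
    using intp by (rule borel_measurable_integrable)
  show "integrable lebesgue (\<lambda>t. k t * tomographic_projection w F t)"
    using integral_completion_AE_eq(2)[OF pm ae'] intp by simp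
  have "AE y in lborel. k (y \<bullet> w) * F y = k (y \<bullet> w) * F' y"
    using ae by (rule eventually_mono) simp
  then have "(LINT y | lebesgue. k (y \<bullet> w) * F y) = (LINT y | lborel. k (y \<bullet> w) * F' y)"
    by (intro integral_completion_AE_eq(1)) measurable
  moreover have "(LINT t | lebesgue. k t * tomographic_projection w F t) = (LINT t | lborel. k t * p t)"
    using pm ae' by (rule integral_completion_AE_eq(1))
  ultimately show "(LINT t | lebesgue. k t * tomographic_projection w F t) = (LINT y | lebesgue. k (y \<bullet> w) * F y)"
    by (simp add: p_eq)
qed

lemma tomographic_projection_eq_0:
  fixes w :: "'a::euclidean_space"
  assumes w: "norm w = 1" and F: "\<And>y. y \<bullet> w = t \<Longrightarrow> F y = 0"
  shows "tomographic_projection w F t = 0"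
proof -
  define U where "U = (SOME U. orthonormal_basis U {v. w \<bullet> v = 0})"
  have U: "orthonormal_basis U {v. w \<bullet> v = 0}"
    unfolding U_def using orthonormal_basis_hyperplane_exists by (rule someI_ex)
  have "F (t *\<^sub>R w + (\<Sum>u\<in>U. s u *\<^sub>R u)) = 0" for s
    using F[of "frame_point w U (t, s)"] frame_point_inner(1)[OF w U] by (simp add: frame_point_def)
  then show ?thesis
    by (simp add: tomographic_projection_def Let_def flip: U_def)
qed

section \<open>Powers and norms of nonnegative functions\<close>

lemma ennpow_ennreal: "0 \<le> a \<Longrightarrow> ennpow (ennreal a) q = ennreal (a powr q)"
  by (simp add: ennpow_def)

lemma ennpow_top [simp]: "ennpow top q = top"
  by (simp add: ennpow_def)

lemma ennpow_0 [simp]: "ennpow 0 q = 0"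
  by (simp add: ennpow_def)

lemma ennpow_1 [simp]: "ennpow x 1 = x"
  by (cases x) (auto simp: ennpow_ennreal)

lemma ennpow_mono: "0 \<le> q \<Longrightarrow> x \<le> y \<Longrightarrow> ennpow x q \<le> ennpow y q"
  by (cases x; cases y) (auto simp: ennpow_ennreal powr_mono2 top_unique)

lemma ennpow_cmult:
  assumes "0 < c"
  shows "ennpow (ennreal c * x) q = ennreal (c powr q) * ennpow x q"
  using assms by (cases x)
    (auto simp: ennpow_ennreal powr_mult ennreal_mult_top simp flip: ennreal_mult)

lemma ennpow_inverse: "0 < q \<Longrightarrow> ennpow (ennpow x q) (1 / q) = x"
  by (cases x) (auto simp: ennpow_ennreal powr_powr)

lemma measurable_ennpow [measurable]: "(\<lambda>x. ennpow x q) \<in> borel_measurable borel"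
  unfolding ennpow_def by measurable

lemma enn2real_exponent: "1 \<le> p \<Longrightarrow> p \<noteq> \<infinity> \<Longrightarrow> 1 \<le> enn2real p"
  by (cases p) auto

text \<open>
  The right-hand side is the tangent line at \<open>c\<^sup>q\<close> of the concave function \<open>u \<mapsto> u\<^bsup>1/q\<^esup>\<close>, evaluated at \<open>a\<^sup>q\<close>; it is the
  form of Young's inequality from which Hoelder's inequality with a constant factor is obtained by optimising \<open>c\<close>.
\<close>

lemma Young_affine_bound:
  fixes a c q :: real
  assumes "0 \<le> a" "0 < c" "1 \<le> q"
  shows "a \<le> c powr (1 - q) / q * a powr q + c * (1 - 1 / q)"
proof (cases "a = 0")
  case True
  then show ?thesis using assms by simp
next
  case False
  then have a: "a > 0" using assms by simp
  have "(c powr (1 - q) * a powr q) powr (1 / q) * c powr (1 - 1 / q)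
      \<le> 1 / q * (c powr (1 - q) * a powr q) + (1 - 1 / q) * c"
    using assms a by (intro Youngs_inequality_0) auto
  moreover have "(c powr (1 - q) * a powr q) powr (1 / q) = c powr ((1 - q) / q) * a"
    using assms a by (simp add: powr_mult powr_powr)
  moreover have "c powr ((1 - q) / q) * c powr (1 - 1 / q) = 1"
    using assms by (simp add: diff_divide_distrib flip: powr_add)
  ultimately show ?thesis
    by (simp add: mult.commute mult.left_commute)
qed

text \<open>
  Hoelder's inequality for the product of \<open>f\<close> and an indicator. The number \<open>m\<close> is a positive upper bound for the measure of \<open>A\<close>
  rather than that measure itself, so that its powers are meaningful for null sets and for \<open>q = 1\<close>.
\<close>

lemma ennpow_nn_integral_le:
  fixes f :: "'a \<Rightarrow> ennreal" and q m :: real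
  assumes q: "1 \<le> q" and m: "0 < m" and f [measurable]: "f \<in> borel_measurable M"
    and A [measurable]: "A \<in> sets M" and mA: "emeasure M A \<le> ennreal m"
  shows "ennpow (\<integral>\<^sup>+x. f x * indicator A x \<partial>M) q
    \<le> ennreal (m powr (q - 1)) * (\<integral>\<^sup>+x. ennpow (f x) q * indicator A x \<partial>M)"
proof (cases "\<integral>\<^sup>+x. ennpow (f x) q * indicator A x \<partial>M")
  case top
  then show ?thesis
    using m by (simp add: ennreal_mult_top)
next
  case (real i)
  have bound: "(\<integral>\<^sup>+x. f x * indicator A x \<partial>M) \<le> ennreal (c powr (1 - q) / q * i + c * (1 - 1 / q) * m)"
    if c: "0 < c" for c
  proof -
    have "f x * indicator A x \<le> ennreal (c powr (1 - q) / q) * (ennpow (f x) q * indicator A x)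
        + ennreal (c * (1 - 1 / q)) * indicator A x" for x
    proof (cases "f x")
      case top
      then show ?thesis
        using c q by (auto simp: indicator_def ennreal_mult_top)
    next
      case (real a)
      then show ?thesis
        using Young_affine_bound[of a c q] c q
        by (auto simp: indicator_def ennpow_ennreal simp flip: ennreal_mult ennreal_plus)
    qed
    then have "(\<integral>\<^sup>+x. f x * indicator A x \<partial>M) \<le> (\<integral>\<^sup>+x. ennreal (c powr (1 - q) / q) * (ennpow (f x) q * indicator A x)
        + ennreal (c * (1 - 1 / q)) * indicator A x \<partial>M)"
      by (intro nn_integral_mono)
    also have "\<dots> = ennreal (c powr (1 - q) / q) * ennreal i + ennreal (c * (1 - 1 / q)) * emeasure M A"
      by (simp add: nn_integral_add nn_integral_cmult real(2))
    also have "\<dots> \<le> ennreal (c powr (1 - q) / q) * ennreal i + ennreal (c * (1 - 1 / q)) * ennreal m"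
      by (intro add_left_mono mult_left_mono mA) simp
    also have "\<dots> = ennreal (c powr (1 - q) / q * i + c * (1 - 1 / q) * m)"
      using c q m real(1) by (simp flip: ennreal_mult ennreal_plus)
    finally show ?thesis .
  qed
  show ?thesis
  proof (cases "i = 0")
    case True
    have "AE x in M. ennpow (f x) q * indicator A x = 0"
      using real True by (intro nn_integral_0_iff_AE[THEN iffD1]) simp_all
    then have "AE x in M. f x * indicator A x = 0"
    proof (rule eventually_mono)
      fix x assume "ennpow (f x) q * indicator A x = 0"
      then show "f x * indicator A x = 0"
        by (cases "f x") (auto simp: ennpow_ennreal indicator_def split: if_splits)
    qed
    then have "(\<integral>\<^sup>+x. f x * indicator A x \<partial>M) = 0"
      by (subst nn_integral_0_iff_AE) auto
    then show ?thesis by simp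
  next
    case False
    then have i: "0 < i" using real by simp
    \<comment> \<open>this \<open>c\<close> minimises the bound; the minimum is \<open>c m\<close>, whose \<open>q\<close>-th power is \<open>m\<^bsup>q-1\<^esup> i\<close>\<close>
    define c where "c = (i / m) powr (1 / q)"
    have c: "0 < c" using i m by (simp add: c_def)
    have cq: "c powr q = i / m" using q i m by (simp add: c_def powr_powr)
    have "c powr (1 - q) * i = c * m"
      using cq c i m by (simp add: powr_diff field_simps)
    then have "c powr (1 - q) / q * i + c * (1 - 1 / q) * m = c * m"
      using q by (simp add: field_simps)
    then have "ennpow (\<integral>\<^sup>+x. f x * indicator A x \<partial>M) q \<le> ennpow (ennreal (c * m)) q"
      using bound[OF c] q by (intro ennpow_mono) auto
    also have "\<dots> = ennreal (m powr (q - 1) * i)"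
      using c m by (simp add: ennpow_ennreal powr_mult powr_diff cq mult.commute)
    finally show ?thesis
      using real m by (simp add: ennreal_mult)
  qed
qed

section \<open>Level sets crossed by a displacement\<close>

text \<open>The points that the displacement \<open>T\<close> carries across the hyperplane at height \<open>x\<close>, in either direction.\<close>

definition crossing :: "'a::real_inner \<Rightarrow> ('a \<Rightarrow> 'a) \<Rightarrow> real \<Rightarrow> 'a set" where
  "crossing w T x = {y. (y \<bullet> w \<le> x) \<noteq> (T y \<bullet> w \<le> x)}"

lemma pred_crossing [measurable]:
  fixes w :: "'a::euclidean_space"
  assumes [measurable]: "T \<in> borel \<rightarrow>\<^sub>M borel"
  shows "Measurable.pred (borel \<Otimes>\<^sub>M borel) (\<lambda>(x, y). y \<in> crossing w T x)"
  unfolding crossing_def by measurable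

lemma crossing_sets [measurable]:
  fixes w :: "'a::euclidean_space"
  assumes [measurable]: "T \<in> borel \<rightarrow>\<^sub>M borel"
  shows "crossing w T x \<in> sets borel"
  unfolding crossing_def by measurable

lemma crossing_levels:
  fixes w :: "'a::real_inner"
  assumes "norm w = 1"
  shows "emeasure lborel {x. y \<in> crossing w T x} \<le> ennreal (norm (y - T y))"
proof -
  have "{x. y \<in> crossing w T x} = {min (y \<bullet> w) (T y \<bullet> w) ..< max (y \<bullet> w) (T y \<bullet> w)}"
    by (auto simp: crossing_def)
  then have "emeasure lborel {x. y \<in> crossing w T x} = ennreal \<bar>(y - T y) \<bullet> w\<bar>"
    by (auto simp: inner_diff_left abs_if min_def max_def)
  also have "\<dots> \<le> ennreal (norm (y - T y))"
    using Cauchy_Schwarz_ineq2[of "y - T y" w] assms by (simp add: ennreal_leI)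
  finally show ?thesis .
qed

text \<open>Integrating over the height first leaves at each point a factor that is at most its displacement.\<close>

lemma nn_integral_crossing:
  fixes w :: "'a::euclidean_space" and H :: "'a \<Rightarrow> ennreal"
  assumes w: "norm w = 1" and T [measurable]: "T \<in> borel \<rightarrow>\<^sub>M borel" and H [measurable]: "H \<in> borel_measurable borel"
    and close: "\<And>y. H y \<noteq> 0 \<Longrightarrow> norm (y - T y) \<le> \<epsilon>"
  shows "(\<integral>\<^sup>+x. \<integral>\<^sup>+y. H y * indicator (crossing w T x) y \<partial>lborel \<partial>lborel) \<le> ennreal \<epsilon> * (\<integral>\<^sup>+y. H y \<partial>lborel)"
proof -
  have "(\<integral>\<^sup>+x. \<integral>\<^sup>+y. H y * indicator (crossing w T x) y \<partial>lborel \<partial>lborel)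
      = (\<integral>\<^sup>+y. \<integral>\<^sup>+x. H y * indicator (crossing w T x) y \<partial>lborel \<partial>lborel)"
    by (intro lborel_pair.Fubini'[symmetric]) (simp add: indicator_def)
  also have "\<dots> \<le> (\<integral>\<^sup>+y. ennreal \<epsilon> * H y \<partial>lborel)"
  proof (rule nn_integral_mono)
    fix y
    have [measurable]: "{x. y \<in> crossing w T x} \<in> sets borel"
      unfolding crossing_def by simp
    have "(\<integral>\<^sup>+x. H y * indicator (crossing w T x) y \<partial>lborel)
        = (\<integral>\<^sup>+x. H y * indicator {x. y \<in> crossing w T x} x \<partial>lborel)"
      by (simp add: indicator_def)
    also have "\<dots> = H y * emeasure lborel {x. y \<in> crossing w T x}"
      by (subst nn_integral_cmult) auto
    also have "\<dots> \<le> H y * ennreal \<epsilon>"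
    proof (cases "H y = 0")
      case False
      then show ?thesis
        using close crossing_levels[OF w, of y T] by (intro mult_left_mono) (auto intro: order_trans ennreal_leI)
    qed simp
    finally show "(\<integral>\<^sup>+x. H y * indicator (crossing w T x) y \<partial>lborel) \<le> ennreal \<epsilon> * H y"
      by (simp add: mult.commute)
  qed
  also have "\<dots> = ennreal \<epsilon> * (\<integral>\<^sup>+y. H y \<partial>lborel)"
    by (simp add: nn_integral_cmult)
  finally show ?thesis .
qed

text \<open>
  In frame coordinates the set lies in a box: the coordinate along \<open>w\<close> ranges over an interval of length \<open>2 e\<close>, and by the bound
  on the diameter each of the remaining \<open>d - 1\<close> coordinates ranges over an interval of length \<open>r\<close>.
\<close>

lemma emeasure_slab_le:
  fixes S :: "(real ^ 'n::finite) set"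
  assumes w: "norm w = 1" and S [measurable]: "S \<in> sets borel"
    and bdd: "bounded S" and diam: "\<And>y z. y \<in> S \<Longrightarrow> z \<in> S \<Longrightarrow> norm (y - z) \<le> r" and r: "0 \<le> r" and e: "0 \<le> e"
  shows "emeasure lborel {y \<in> S. \<bar>y \<bullet> w - x\<bar> \<le> e} \<le> ennreal (2 * e * r ^ (CARD('n) - 1))"
proof -
  obtain U where U: "orthonormal_basis U {v. w \<bullet> v = 0}"
    using orthonormal_basis_hyperplane_exists by blast
  note B = orthonormal_basis_hyperplane[OF w U]
  interpret product_sigma_finite "\<lambda>u :: real ^ 'n. lborel :: real measure" ..
  interpret PU: sigma_finite_measure "\<Pi>\<^sub>M u\<in>U. (lborel :: real measure)"
    using sigma_finite[OF B(1)] .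
  let ?M = "lborel \<Otimes>\<^sub>M (\<Pi>\<^sub>M u\<in>U. (lborel :: real measure))"
  \<comment> \<open>the lower corner of the bounding box of \<open>S\<close> in frame coordinates\<close>
  define c where "c = (\<lambda>u. Inf ((\<lambda>y. y \<bullet> u) ` S))"
  have c: "c u \<le> y \<bullet> u \<and> y \<bullet> u \<le> c u + r" if "y \<in> S" "u \<in> U" for y u
  proof
    have u: "norm u = 1"
      using U that(2) by (simp add: orthonormal_basis_def)
    have "bounded ((\<lambda>y. y \<bullet> u) ` S)"
      by (rule bounded_linear_image[OF bdd bounded_linear_inner_left])
    then show "c u \<le> y \<bullet> u"
      unfolding c_def using that(1) by (intro cInf_lower bounded_imp_bdd_below) auto
    have "y \<bullet> u - r \<le> c u"
      unfolding c_def
    proof (rule cInf_greatest)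
      fix a assume "a \<in> (\<lambda>y. y \<bullet> u) ` S"
      then obtain z where z: "z \<in> S" "a = z \<bullet> u" by blast
      have "(y - z) \<bullet> u \<le> norm (y - z)"
        using norm_cauchy_schwarz[of "y - z" u] u by simp
      also have "\<dots> \<le> r"
        using diam that(1) z(1) by blast
      finally show "y \<bullet> u - r \<le> a"
        using z by (simp add: inner_diff_left)
    qed (use that in auto)
    then show "y \<bullet> u \<le> c u + r" by simp
  qed
  let ?S = "{y \<in> S. \<bar>y \<bullet> w - x\<bar> \<le> e}"
  have "emeasure lborel ?S = emeasure (distr ?M borel (frame_point w U)) ?S"
    by (simp add: lborel_frame[OF w U])
  also have "\<dots> = emeasure ?M (frame_point w U -` ?S \<inter> space ?M)"
    by (rule emeasure_distr) simp_all
  also have "\<dots> \<le> emeasure ?M ({x - e..x + e} \<times> (\<Pi>\<^sub>E u\<in>U. {c u..c u + r}))"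
  proof (rule emeasure_mono)
    show "frame_point w U -` ?S \<inter> space ?M \<subseteq> {x - e..x + e} \<times> (\<Pi>\<^sub>E u\<in>U. {c u..c u + r})"
    proof (intro subsetI)
      fix z assume z: "z \<in> frame_point w U -` ?S \<inter> space ?M"
      obtain t s where ts: "z = (t, s)" by fastforce
      have S: "frame_point w U (t, s) \<in> S" and "\<bar>t - x\<bar> \<le> e" and s: "s \<in> (\<Pi>\<^sub>E u\<in>U. UNIV)"
        using z by (auto simp: ts frame_point_inner[OF w U] space_pair_measure space_PiM)
      then show "z \<in> {x - e..x + e} \<times> (\<Pi>\<^sub>E u\<in>U. {c u..c u + r})"
        using c[OF S] by (auto simp: ts frame_point_inner[OF w U] PiE_iff)
    qed

    show "{x - e..x + e} \<times> (\<Pi>\<^sub>E u\<in>U. {c u..c u + r}) \<in> sets ?M"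
      using B(1) by (intro pair_measureI sets_PiM_I_finite) auto
  qed
  also have "\<dots> = ennreal (2 * e) * (\<Prod>u\<in>U. ennreal r)"
    using e r B(1) by (subst PU.emeasure_pair_measure_Times) (auto simp: emeasure_PiM sets_PiM_I_finite)
  also have "\<dots> = ennreal (2 * e * r ^ (CARD('n) - 1))"
    using e r B(3) by (simp add: ennreal_mult ennreal_power)
  finally show ?thesis .
qed

text \<open>A point displaced by at most \<open>\<epsilon>\<close> can cross only hyperplanes at distance at most \<open>\<epsilon>\<close>.\<close>

lemma emeasure_crossing_le:
  fixes S :: "(real ^ 'n::finite) set"
  assumes w: "norm w = 1" and S [measurable]: "S \<in> sets borel"
    and bdd: "bounded S" and diam: "\<And>y z. y \<in> S \<Longrightarrow> z \<in> S \<Longrightarrow> norm (y - z) \<le> r" and r: "0 \<le> r" and e: "0 \<le> \<epsilon>"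
    and close: "\<And>y. y \<in> S \<Longrightarrow> norm (y - T y) \<le> \<epsilon>"
  shows "emeasure lborel (S \<inter> crossing w T x) \<le> ennreal (2 * \<epsilon> * r ^ (CARD('n) - 1))"
proof -
  have "S \<inter> crossing w T x \<subseteq> {y \<in> S. \<bar>y \<bullet> w - x\<bar> \<le> \<epsilon>}"
  proof safe
    fix y assume "y \<in> S" "y \<in> crossing w T x"
    have "\<bar>(y - T y) \<bullet> w\<bar> \<le> norm (y - T y)"
      using Cauchy_Schwarz_ineq2[of "y - T y" w] w by simp
    also have "\<dots> \<le> \<epsilon>"
      using close \<open>y \<in> S\<close> by blast
    finally show "\<bar>y \<bullet> w - x\<bar> \<le> \<epsilon>"
      using \<open>y \<in> crossing w T x\<close> by (auto simp: crossing_def inner_diff_left)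
  qed
  then have "emeasure lborel (S \<inter> crossing w T x) \<le> emeasure lborel {y \<in> S. \<bar>y \<bullet> w - x\<bar> \<le> \<epsilon>}"
    by (rule emeasure_mono) simp
  also have "\<dots> \<le> ennreal (2 * \<epsilon> * r ^ (CARD('n) - 1))"
    using w S bdd diam r e by (rule emeasure_slab_le)
  finally show ?thesis .
qed

section \<open>Norm estimates for the crossing integral\<close>

lemma esssup_completion:
  fixes f :: "'a \<Rightarrow> ennreal"
  assumes "f \<in> borel_measurable M"
  shows "esssup (completion M) f = esssup M f"
  using assms by (simp add: esssup_eq_AE measurable_completion AE_completion_iff)

lemma Lp_ennorm_completion_AE_eq:
  assumes g: "g \<in> borel_measurable M" and ae: "AE x in M. f x = g x"
  shows "Lp_ennorm (completion M) p f = Lp_ennorm M p g"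
proof (cases "p = \<infinity>")
  case True
  have "esssup (completion M) f = esssup (completion M) g"
    using assms by (intro esssup_AE_cong measurable_completion_AE_eq[OF g ae] measurable_completion AE_completion) auto
  then show ?thesis
    using True esssup_completion[OF g] by (simp add: Lp_ennorm_def)
next
  case False
  have "(\<integral>\<^sup>+x. ennpow (f x) (enn2real p) \<partial>M) = (\<integral>\<^sup>+x. ennpow (g x) (enn2real p) \<partial>M)"
    using ae by (intro nn_integral_cong_AE) (auto elim: eventually_mono)
  then show ?thesis
    using False by (simp add: Lp_ennorm_def nn_integral_completion)
qed

lemma Lp_ennorm_mono:
  assumes "1 \<le> p" "f \<in> borel_measurable M" "\<And>x. x \<in> space M \<Longrightarrow> f x \<le> g x"
  shows "Lp_ennorm M p f \<le> Lp_ennorm M p g"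
proof (cases "p = \<infinity>")
  case True
  then show ?thesis
    using assms by (auto simp: Lp_ennorm_def intro!: esssup_AE_mono)
next
  case False
  then have "1 \<le> enn2real p"
    using assms(1) enn2real_exponent by simp
  then show ?thesis
    using False assms(3) by (auto simp: Lp_ennorm_def intro!: ennpow_mono nn_integral_mono)
qed

lemma Lp_ennorm_1: "Lp_ennorm M 1 f = (\<integral>\<^sup>+x. f x \<partial>M)"
  by (simp add: Lp_ennorm_def)

text \<open>
  The norm over a probability space of a function bounded by \<open>c\<close>. The essential supremum of a nonmeasurable function
  is infinite by convention, hence the hypothesis for \<open>p = \<infinity>\<close>.
\<close>

lemma Lp_ennorm_const_bound:
  assumes "prob_space M" "1 \<le> p" "p = \<infinity> \<Longrightarrow> f \<in> borel_measurable M" "\<And>x. x \<in> space M \<Longrightarrow> f x \<le> c"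
  shows "Lp_ennorm M p f \<le> c"
proof (cases "p = \<infinity>")
  case True
  then show ?thesis
    using assms by (auto simp: Lp_ennorm_def)
next
  case False
  interpret prob_space M by fact
  have q: "1 \<le> enn2real p"
    using assms(2) False enn2real_exponent by simp
  have "(\<integral>\<^sup>+x. ennpow (f x) (enn2real p) \<partial>M) \<le> (\<integral>\<^sup>+x. ennpow c (enn2real p) \<partial>M)"
    using assms(4) q by (intro nn_integral_mono ennpow_mono) auto
  also have "\<dots> = ennpow c (enn2real p)"
    by (simp add: emeasure_space_1)
  finally have "ennpow (\<integral>\<^sup>+x. ennpow (f x) (enn2real p) \<partial>M) (1 / enn2real p)
      \<le> ennpow (ennpow c (enn2real p)) (1 / enn2real p)"
    using q by (intro ennpow_mono) auto
  then show ?thesis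
    using False q by (simp add: Lp_ennorm_def ennpow_inverse)
qed

lemma measurable_nn_integral_crossing [measurable]:
  fixes w :: "'a::euclidean_space" and H :: "'a \<Rightarrow> ennreal"
  assumes [measurable]: "T \<in> borel \<rightarrow>\<^sub>M borel" "H \<in> borel_measurable borel"
  shows "(\<lambda>x. \<integral>\<^sup>+y. H y * indicator (crossing w T x) y \<partial>lborel) \<in> borel_measurable borel"
  by (intro lborel.borel_measurable_nn_integral) (simp add: indicator_def)

text \<open>
  Interpolation between the supremum and the integral of the crossing function \<open>g\<close>: if \<open>n\<close> is the integral of \<open>H\<close>, then
  \<open>g\<^sup>q \<le> n\<^bsup>q-1\<^esup> g\<close> pointwise and \<open>\<integral> g \<le> \<epsilon> n\<close>.
\<close>

lemma Lp_crossing_le_L1: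
  fixes w :: "'a::euclidean_space" and H :: "'a \<Rightarrow> ennreal"
  assumes w: "norm w = 1" and T [measurable]: "T \<in> borel \<rightarrow>\<^sub>M borel" and H [measurable]: "H \<in> borel_measurable borel"
    and close: "\<And>y. H y \<noteq> 0 \<Longrightarrow> norm (y - T y) \<le> \<epsilon>" and \<epsilon>: "0 < \<epsilon>" and p: "1 \<le> p"
  shows "Lp_ennorm lborel p (\<lambda>x. \<integral>\<^sup>+y. H y * indicator (crossing w T x) y \<partial>lborel)
    \<le> ennreal (\<epsilon> powr recip_exponent p) * (\<integral>\<^sup>+y. H y \<partial>lborel)"
proof -
  let ?g = "\<lambda>x. \<integral>\<^sup>+y. H y * indicator (crossing w T x) y \<partial>lborel"
  have g_le: "?g x \<le> (\<integral>\<^sup>+y. H y \<partial>lborel)" for x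
    by (intro nn_integral_mono) (auto simp: indicator_def)
  show ?thesis
  proof (cases "p = \<infinity>")
    case True
    then show ?thesis
      using g_le \<epsilon> by (auto simp: Lp_ennorm_def recip_exponent_def intro!: esssup_I)
  next
    case False
    define q where "q = enn2real p"
    have q: "1 \<le> q"
      using enn2real_exponent[OF p False] by (simp add: q_def)
    show ?thesis
    proof (cases "\<integral>\<^sup>+y. H y \<partial>lborel")
      case top
      then show ?thesis
        using \<epsilon> by (simp add: ennreal_mult_top)
    next
      case (real n)
      have "ennpow (?g x) q \<le> ennreal (n powr (q - 1)) * ?g x" for x
      proof (cases "?g x")
        case top
        then show ?thesis
          using g_le[of x] real by (simp add: top_unique)
      next
        case (real a)
        then have "a \<le> n"
          using g_le[of x] \<open>0 \<le> n\<close> \<open>(\<integral>\<^sup>+y. H y \<partial>lborel) = ennreal n\<close> by simp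
        have "a powr q = a powr (q - 1) * a"
          using real(1) by (cases "a = 0") (simp_all add: powr_diff)
        also have "\<dots> \<le> n powr (q - 1) * a"
          using \<open>a \<le> n\<close> real(1) q by (intro mult_right_mono powr_mono2) auto
        finally show ?thesis
          using real by (simp add: ennpow_ennreal flip: ennreal_mult)
      qed
      then have "(\<integral>\<^sup>+x. ennpow (?g x) q \<partial>lborel) \<le> (\<integral>\<^sup>+x. ennreal (n powr (q - 1)) * ?g x \<partial>lborel)"
        by (intro nn_integral_mono)
      also have "\<dots> = ennreal (n powr (q - 1)) * (\<integral>\<^sup>+x. ?g x \<partial>lborel)"
        by (rule nn_integral_cmult) measurable
      also have "\<dots> \<le> ennreal (n powr (q - 1)) * (ennreal \<epsilon> * ennreal n)"
        using nn_integral_crossing[OF w T H close] real(2) by (intro mult_left_mono) auto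
      also have "\<dots> = ennreal (\<epsilon> * n powr q)"
      proof -
        have "n powr (q - 1) * n = n powr q"
          using real(1) by (cases "n = 0") (simp_all add: powr_diff)
        then show ?thesis
          using real(1) \<epsilon> by (simp add: mult.left_commute flip: ennreal_mult)
      qed
      finally have "ennpow (\<integral>\<^sup>+x. ennpow (?g x) q \<partial>lborel) (1 / q) \<le> ennpow (ennreal (\<epsilon> * n powr q)) (1 / q)"
        using q by (intro ennpow_mono) auto
      also have "\<dots> = ennreal (\<epsilon> powr (1 / q) * n)"
        using \<epsilon> q real(1) by (simp add: ennpow_ennreal powr_mult powr_powr)
      finally show ?thesis
        using False real \<epsilon> by (simp add: Lp_ennorm_def recip_exponent_def q_def ennreal_mult)
    qed
  qed
qed

text \<open>
  Hoelder's inequality at a fixed height costs the factor \<open>m\<^bsup>q-1\<^esup>\<close>, where \<open>m\<close> bounds the volume of the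
  crossing set; integrating over the heights costs \<open>\<epsilon>\<close>. The root of \<open>m\<^bsup>q-1\<^esup> \<epsilon>\<close> is exactly \<open>\<epsilon>\<close> times the stated
  constant.
\<close>

lemma Lp_crossing_le_Lp:
  fixes w :: "real ^ 'n::finite" and H :: "real ^ 'n \<Rightarrow> ennreal"
  assumes w: "norm w = 1" and T [measurable]: "T \<in> borel \<rightarrow>\<^sub>M borel" and H [measurable]: "H \<in> borel_measurable borel"
    and S [measurable]: "S \<in> sets borel" and bdd: "bounded S"
    and diam: "\<And>y z. y \<in> S \<Longrightarrow> z \<in> S \<Longrightarrow> norm (y - z) \<le> r" and r: "0 < r"
    and close: "\<And>y. y \<in> S \<Longrightarrow> norm (y - T y) \<le> \<epsilon>" and \<epsilon>: "0 < \<epsilon>"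
    and supp: "\<And>y. y \<notin> S \<Longrightarrow> H y = 0" and p: "1 \<le> p"
  shows "Lp_ennorm lborel p (\<lambda>x. \<integral>\<^sup>+y. H y * indicator (crossing w T x) y \<partial>lborel)
    \<le> ennreal \<epsilon> * Lp_ennorm lborel p H * ennreal (C_const p CARD('n) r)"
proof -
  let ?A = "\<lambda>x. S \<inter> crossing w T x"
  let ?g = "\<lambda>x. \<integral>\<^sup>+y. H y * indicator (crossing w T x) y \<partial>lborel"
  define m where "m = 2 * \<epsilon> * r ^ (CARD('n) - 1)"
  have m: "0 < m"
    using \<epsilon> r by (simp add: m_def)
  have mA: "emeasure lborel (?A x) \<le> ennreal m" for x
    unfolding m_def using r \<epsilon> by (intro emeasure_crossing_le w S bdd diam close) auto
  have gA: "?g x = (\<integral>\<^sup>+y. H y * indicator (?A x) y \<partial>lborel)" for x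
    using supp by (intro nn_integral_cong) (auto simp: indicator_def)
  show ?thesis
  proof (cases "p = \<infinity>")
    case True
    have "?g x \<le> ennreal m * esssup lborel H" for x
    proof -
      have "?g x \<le> (\<integral>\<^sup>+y. esssup lborel H * indicator (?A x) y \<partial>lborel)"
        unfolding gA using esssup_AE[of H lborel]
        by (intro nn_integral_mono_AE) (auto simp: indicator_def elim: eventually_mono)
      also have "\<dots> = esssup lborel H * emeasure lborel (?A x)"
        by (rule nn_integral_cmult_indicator) simp
      also have "\<dots> \<le> esssup lborel H * ennreal m"
        by (intro mult_left_mono mA) simp
      finally show ?thesis
        by (simp add: mult.commute)
    qed
    then have "esssup lborel ?g \<le> ennreal m * esssup lborel H"
      by (intro esssup_I) auto
    also have "ennreal m = ennreal \<epsilon> * ennreal (C_const \<infinity> CARD('n) r)"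
    proof -
      have "r ^ (CARD('n) - 1) = r powr (real (CARD('n) - 1) * 1)"
        using r by (simp only: powr_realpow mult_1_right)
      then have "m = \<epsilon> * C_const \<infinity> CARD('n) r"
        by (simp only: m_def C_const_def recip_conj_exponent_def) simp
      then show ?thesis
        using \<epsilon> by (simp add: ennreal_mult')
    qed
    finally show ?thesis
      using True by (simp add: Lp_ennorm_def mult.commute mult.left_commute)
  next
    case False
    define q where "q = enn2real p"
    have q: "1 \<le> q"
      using enn2real_exponent[OF p False] by (simp add: q_def)
    define I where "I = (\<integral>\<^sup>+y. ennpow (H y) q \<partial>lborel)"
    have Hq: "H y \<noteq> 0" if "ennpow (H y) q \<noteq> 0" for y
      using that by auto
    have "(\<integral>\<^sup>+x. ennpow (?g x) q \<partial>lborel)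
        \<le> (\<integral>\<^sup>+x. ennreal (m powr (q - 1)) * (\<integral>\<^sup>+y. ennpow (H y) q * indicator (crossing w T x) y \<partial>lborel) \<partial>lborel)"
    proof (rule nn_integral_mono)
      fix x
      have "ennpow (?g x) q \<le> ennreal (m powr (q - 1)) * (\<integral>\<^sup>+y. ennpow (H y) q * indicator (?A x) y \<partial>lborel)"
        unfolding gA using q m mA by (intro ennpow_nn_integral_le) auto
      also have "\<dots> \<le> ennreal (m powr (q - 1)) * (\<integral>\<^sup>+y. ennpow (H y) q * indicator (crossing w T x) y \<partial>lborel)"
        by (intro mult_left_mono nn_integral_mono) (auto simp: indicator_def)
      finally show "ennpow (?g x) q
          \<le> ennreal (m powr (q - 1)) * (\<integral>\<^sup>+y. ennpow (H y) q * indicator (crossing w T x) y \<partial>lborel)" .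
    qed
    also have "\<dots> = ennreal (m powr (q - 1))
        * (\<integral>\<^sup>+x. \<integral>\<^sup>+y. ennpow (H y) q * indicator (crossing w T x) y \<partial>lborel \<partial>lborel)"
      by (rule nn_integral_cmult) measurable
    also have "\<dots> \<le> ennreal (m powr (q - 1)) * (ennreal \<epsilon> * I)"
      unfolding I_def using Hq supp close by (intro mult_left_mono nn_integral_crossing w) auto
    also have "\<dots> = ennreal (m powr (q - 1) * \<epsilon>) * I"
      using \<epsilon> by (simp add: ennreal_mult mult.assoc)
    finally have "ennpow (\<integral>\<^sup>+x. ennpow (?g x) q \<partial>lborel) (1 / q) \<le> ennpow (ennreal (m powr (q - 1) * \<epsilon>) * I) (1 / q)"
      using q by (intro ennpow_mono) auto
    also have "\<dots> = ennreal ((m powr (q - 1) * \<epsilon>) powr (1 / q)) * ennpow I (1 / q)"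
      using m \<epsilon> by (intro ennpow_cmult) simp
    also have "(m powr (q - 1) * \<epsilon>) powr (1 / q) = \<epsilon> * C_const p CARD('n) r"
    proof -
      let ?a = "(q - 1) / q"
      have "(m powr (q - 1) * \<epsilon>) powr (1 / q) = m powr ?a * \<epsilon> powr (1 / q)"
        using m \<epsilon> by (simp add: powr_mult powr_powr)
      also have "m powr ?a = 2 powr ?a * \<epsilon> powr ?a * r powr (real (CARD('n) - 1) * ?a)"
        using \<epsilon> r by (simp add: m_def powr_mult powr_powr flip: powr_realpow)
      also have "\<epsilon> powr ?a = \<epsilon> / \<epsilon> powr (1 / q)"
        using \<epsilon> q by (simp add: diff_divide_distrib powr_diff)
      finally show ?thesis
        using False \<epsilon> by (simp add: C_const_def recip_conj_exponent_def q_def)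
    qed
    finally have "ennpow (\<integral>\<^sup>+x. ennpow (?g x) q \<partial>lborel) (1 / q)
        \<le> ennreal (\<epsilon> * C_const p CARD('n) r) * ennpow I (1 / q)" .
    then show ?thesis
      using False \<epsilon> by (simp add: Lp_ennorm_def I_def q_def ennreal_mult' C_const_def mult.assoc mult.left_commute mult.commute)
  qed
qed

text \<open>
  The two estimates for a Lebesgue measurable density \<open>F\<close>, obtained from a Borel representative of \<open>\<bar>F\<bar>\<close> that is cut
  off outside \<open>S\<close>.
\<close>

lemma Lp_halfspace_difference_le:
  fixes w :: "real ^ 'n::finite" and F :: "real ^ 'n \<Rightarrow> real" and T :: "real ^ 'n \<Rightarrow> real ^ 'n"
  assumes w: "norm w = 1" and T [measurable]: "T \<in> borel \<rightarrow>\<^sub>M borel" and F: "F \<in> borel_measurable lebesgue"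
    and S [measurable]: "S \<in> sets borel" and bdd: "bounded S"
    and diam: "\<And>y z. y \<in> S \<Longrightarrow> z \<in> S \<Longrightarrow> norm (y - z) \<le> r" and r: "0 < r"
    and close: "\<And>y. y \<in> S \<Longrightarrow> norm (y - T y) \<le> \<epsilon>" and \<epsilon>: "0 < \<epsilon>"
    and supp: "\<And>y. y \<notin> S \<Longrightarrow> F y = 0" and p: "1 \<le> p"
    and G [measurable]: "G \<in> borel_measurable borel"
    and G_le: "\<And>x. ennreal \<bar>G x\<bar> \<le> (\<integral>\<^sup>+y. ennreal \<bar>F y\<bar> * indicator (crossing w T x) y \<partial>lebesgue)"
  shows "Lp_norm lebesgue p G \<le> ennreal \<epsilon> * Lp_norm lebesgue p F * ennreal (C_const p CARD('n) r)"
    "Lp_norm lebesgue p G \<le> ennreal (\<epsilon> powr recip_exponent p) * Lp_norm lebesgue 1 F"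
proof -
  obtain F' where F' [measurable]: "F' \<in> borel_measurable lborel" and ae: "AE y in lborel. F y = F' y"
    using completion_ex_borel_measurable_real[OF F] by blast
  define H where "H = (\<lambda>y. ennreal \<bar>F' y\<bar> * indicator S y)"
  have H [measurable]: "H \<in> borel_measurable borel"
    unfolding H_def by measurable
  have aeH: "AE y in lborel. ennreal \<bar>F y\<bar> = H y"
    using ae by (rule eventually_mono) (use supp in \<open>auto simp: H_def indicator_def\<close>)
  have suppH: "H y = 0" if "y \<notin> S" for y
    using that by (simp add: H_def)
  let ?g = "\<lambda>x. \<integral>\<^sup>+y. H y * indicator (crossing w T x) y \<partial>lborel"
  have "ennreal \<bar>G x\<bar> \<le> ?g x" for x
  proof -
    have "(\<integral>\<^sup>+y. ennreal \<bar>F y\<bar> * indicator (crossing w T x) y \<partial>lebesgue) = ?g x"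
      unfolding nn_integral_completion using aeH by (intro nn_integral_cong_AE) (auto elim: eventually_mono)
    then show ?thesis
      using G_le[of x] by simp
  qed
  then have "Lp_ennorm lborel p (\<lambda>x. ennreal \<bar>G x\<bar>) \<le> Lp_ennorm lborel p ?g"
    using p by (intro Lp_ennorm_mono) auto
  moreover have "Lp_norm lebesgue p G = Lp_ennorm lborel p (\<lambda>x. ennreal \<bar>G x\<bar>)"
    unfolding Lp_norm_def by (rule Lp_ennorm_completion_AE_eq) auto
  ultimately have G_g: "Lp_norm lebesgue p G \<le> Lp_ennorm lborel p ?g"
    by simp
  have F_H: "Lp_norm lebesgue s F = Lp_ennorm lborel s H" for s
    unfolding Lp_norm_def using aeH by (intro Lp_ennorm_completion_AE_eq) auto
  show "Lp_norm lebesgue p G \<le> ennreal \<epsilon> * Lp_norm lebesgue p F * ennreal (C_const p CARD('n) r)"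
    unfolding F_H using G_g Lp_crossing_le_Lp[OF w T H S bdd diam r close \<epsilon> suppH p] by (rule order_trans)
  have "H y \<noteq> 0 \<Longrightarrow> norm (y - T y) \<le> \<epsilon>" for y
    using suppH close by blast
  from Lp_crossing_le_L1[OF w T H this \<epsilon> p]
  show "Lp_norm lebesgue p G \<le> ennreal (\<epsilon> powr recip_exponent p) * Lp_norm lebesgue 1 F"
    unfolding F_H Lp_ennorm_1 using G_g by (rule order_trans[rotated])
qed

section \<open>Half-space integrals\<close>

text \<open>
  An essential supremum is at most \<open>c\<close> exactly if the section exceeds \<open>c\<close> on a null set, and by Tonelli the
  measure of the exceptional set depends measurably on the parameter.
\<close>

lemma measurable_esssup:
  fixes f :: "'a \<Rightarrow> 'b \<Rightarrow> ennreal"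
  assumes N: "sigma_finite_measure N" and f [measurable]: "case_prod f \<in> borel_measurable (M \<Otimes>\<^sub>M N)"
  shows "(\<lambda>x. esssup N (f x)) \<in> borel_measurable M"
proof (rule borel_measurableI_le)
  interpret sigma_finite_measure N by fact
  fix c
  have "esssup N (f x) \<le> c \<longleftrightarrow> (\<integral>\<^sup>+y. indicator {y. \<not> f x y \<le> c} y \<partial>N) = 0" if [measurable]: "x \<in> space M" for x
  proof -
    have "esssup N (f x) \<le> c \<longleftrightarrow> (AE y in N. f x y \<le> c)"
      using esssup_AE[of "f x" N] by (auto intro: esssup_I elim: eventually_mono order_trans)
    also have "\<dots> \<longleftrightarrow> (\<integral>\<^sup>+y. indicator {y. \<not> f x y \<le> c} y \<partial>N) = 0"
      by (rule AE_iff_nn_integral) measurable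
    finally show ?thesis .
  qed
  then have "{x \<in> space M. esssup N (f x) \<le> c}
      = {x \<in> space M. (\<integral>\<^sup>+y. indicator {y. \<not> f x y \<le> c} y \<partial>N) = 0}"
    by blast
  also have "\<dots> \<in> sets M"
    by (simp add: indicator_def)
  finally show "{x \<in> space M. esssup N (f x) \<le> c} \<in> sets M" .
qed

definition halfspace_integral :: "('a::euclidean_space \<Rightarrow> real) \<Rightarrow> 'a \<Rightarrow> real \<Rightarrow> real" where
  "halfspace_integral F w x = (LINT y | lebesgue. indicator {..x} (y \<bullet> w) * F y)"

lemma measurable_halfspace_integral:
  assumes F: "F \<in> borel_measurable lebesgue"
  shows "(\<lambda>(w, x). halfspace_integral F w x) \<in> borel_measurable (borel \<Otimes>\<^sub>M borel)"
proof -
  obtain F' where F' [measurable]: "F' \<in> borel_measurable lborel" and ae: "AE y in lborel. F y = F' y"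
    using completion_ex_borel_measurable_real[OF F] by blast
  have "halfspace_integral F w x = (LINT y | lborel. indicator {..x} (y \<bullet> w) * F' y)" for w x
    unfolding halfspace_integral_def
    using ae by (intro integral_completion_AE_eq(1)) (auto elim: eventually_mono)
  then show ?thesis
    by (simp add: indicator_def)
qed

text \<open>The inclusion of \<open>L\<^sup>p\<close> in \<open>L\<^sup>1\<close> on a set of finite measure, by Hoelder's inequality.\<close>

lemma integrable_of_in_Lp_bounded_support:
  fixes F :: "'a::euclidean_space \<Rightarrow> real"
  assumes p: "1 \<le> p" and F: "in_Lp lebesgue p F" and A: "bounded A" "open A"
    and supp: "\<And>x. x \<notin> A \<Longrightarrow> F x = 0"
  shows "integrable lebesgue F"
proof -
  have Fm [measurable]: "F \<in> borel_measurable lebesgue" and fin: "Lp_norm lebesgue p F < \<infinity>"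
    using F by (auto simp: in_Lp_def)
  have Am [measurable]: "A \<in> sets lebesgue"
    using A by simp
  have "emeasure lebesgue A < \<infinity>"
    using A emeasure_bounded_finite[of A] by simp
  then have "emeasure lebesgue A = ennreal (measure lebesgue A)"
    by (intro emeasure_eq_ennreal_measure) auto
  moreover have "0 < measure lebesgue A + 1"
    by (rule add_nonneg_pos) auto
  ultimately obtain m where m: "0 < m" "emeasure lebesgue A \<le> ennreal m"
    by (metis ennreal_leI less_add_one less_imp_le)
  have FA: "(\<integral>\<^sup>+x. ennreal \<bar>F x\<bar> \<partial>lebesgue) = (\<integral>\<^sup>+x. ennreal \<bar>F x\<bar> * indicator A x \<partial>lebesgue)"
    by (intro nn_integral_cong) (use supp in \<open>auto simp: indicator_def\<close>)
  have "(\<integral>\<^sup>+x. ennreal \<bar>F x\<bar> \<partial>lebesgue) < \<infinity>"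
  proof (cases "p = \<infinity>")
    case True
    let ?s = "esssup lebesgue (\<lambda>x. ennreal \<bar>F x\<bar>)"
    have "(\<integral>\<^sup>+x. ennreal \<bar>F x\<bar> * indicator A x \<partial>lebesgue) \<le> (\<integral>\<^sup>+x. ?s * indicator A x \<partial>lebesgue)"
      using esssup_AE[of "\<lambda>x. ennreal \<bar>F x\<bar>" lebesgue]
      by (intro nn_integral_mono_AE) (auto simp: indicator_def elim: eventually_mono)
    also have "\<dots> = ?s * emeasure lebesgue A"
      by (rule nn_integral_cmult_indicator) simp
    also have "\<dots> < \<infinity>"
      using fin True \<open>emeasure lebesgue A < \<infinity>\<close>
      by (simp add: Lp_norm_def Lp_ennorm_def ennreal_mult_less_top)
    finally show ?thesis
      by (simp add: FA)
  next
    case False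
    define q where "q = enn2real p"
    have q: "1 \<le> q"
      using enn2real_exponent[OF p False] by (simp add: q_def)
    let ?I = "\<integral>\<^sup>+x. ennpow (ennreal \<bar>F x\<bar>) q \<partial>lebesgue"
    have "?I \<noteq> top"
    proof
      assume "?I = top"
      then show False
        using fin False by (simp add: Lp_norm_def Lp_ennorm_def q_def)
    qed
    then have "?I < \<infinity>"
      by (simp add: less_top)
    have "ennpow (\<integral>\<^sup>+x. ennreal \<bar>F x\<bar> * indicator A x \<partial>lebesgue) q
        \<le> ennreal (m powr (q - 1)) * (\<integral>\<^sup>+x. ennpow (ennreal \<bar>F x\<bar>) q * indicator A x \<partial>lebesgue)"
      using q m by (intro ennpow_nn_integral_le) auto
    also have "\<dots> \<le> ennreal (m powr (q - 1)) * ?I"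
      by (intro mult_left_mono nn_integral_mono) (auto simp: indicator_def)
    also have "\<dots> < \<infinity>"
      using \<open>?I < \<infinity>\<close> by (simp add: ennreal_mult_less_top)
    finally show ?thesis
      by (cases "(\<integral>\<^sup>+x. ennreal \<bar>F x\<bar> * indicator A x \<partial>lebesgue) = top")
        (simp_all add: FA flip: less_top)
  qed
  then show ?thesis
    by (simp add: integrable_iff_bounded)
qed

text \<open>
  The integrands differ only at points that \<open>S\<close> carries across the hyperplane. The map \<open>T\<close> stands for a
  measurable extension of \<open>S\<close> from the support of \<open>F\<close> to the whole space.
\<close>

lemma halfspace_difference_le_crossing:
  fixes F :: "'a::euclidean_space \<Rightarrow> real"
  assumes "integrable lebesgue (\<lambda>y. indicator {..x} (y \<bullet> w) * F y)"
    and "integrable lebesgue (\<lambda>y. indicator {..x} (S y \<bullet> w) * F y)"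
    and ST: "\<And>y. F y \<noteq> 0 \<Longrightarrow> S y = T y"
  shows "ennreal \<bar>halfspace_integral F w x - (LINT y | lebesgue. indicator {..x} (S y \<bullet> w) * F y)\<bar>
    \<le> (\<integral>\<^sup>+y. ennreal \<bar>F y\<bar> * indicator (crossing w T x) y \<partial>lebesgue)"
proof -
  let ?d = "\<lambda>y. indicator {..x} (y \<bullet> w) * F y - indicator {..x} (S y \<bullet> w) * F y"
  have "ennreal \<bar>halfspace_integral F w x - (LINT y | lebesgue. indicator {..x} (S y \<bullet> w) * F y)\<bar>
      = ennreal (norm (LINT y | lebesgue. ?d y))"
    using assms(1,2) by (simp add: halfspace_integral_def)
  also have "\<dots> \<le> (\<integral>\<^sup>+y. ennreal (norm (?d y)) \<partial>lebesgue)"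
    using assms(1,2) by (intro integral_norm_bound_ennreal Bochner_Integration.integrable_diff)
  also have "\<dots> \<le> (\<integral>\<^sup>+y. ennreal \<bar>F y\<bar> * indicator (crossing w T x) y \<partial>lebesgue)"
  proof (rule nn_integral_mono)
    fix y
    show "ennreal (norm (?d y)) \<le> ennreal \<bar>F y\<bar> * indicator (crossing w T x) y"
      using ST[of y] by (cases "F y = 0") (auto simp: crossing_def indicator_def)
  qed
  finally show ?thesis .
qed

lemma integrable_halfspace:
  fixes F :: "'a::euclidean_space \<Rightarrow> real"
  assumes F: "integrable lebesgue F"
  shows "integrable lebesgue (\<lambda>y. indicator {..x} (y \<bullet> w) * F y)"
proof -
  have "{y. y \<bullet> w \<le> x} \<in> sets lebesgue"
    by (intro sets_completionI_sets) measurable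
  then have "integrable lebesgue (\<lambda>y. indicator {y. y \<bullet> w \<le> x} y *\<^sub>R F y)"
    by (rule integrable_mult_indicator[OF _ F])
  then show ?thesis
    by (simp add: indicator_def)
qed

section \<open>Deformations\<close>

lemma
  fixes \<Phi> :: "real ^ 'n::finite \<Rightarrow> real ^ 'n" and F k :: "real ^ 'n \<Rightarrow> real"
  assumes \<Phi>: "deformation \<epsilon> B A \<Phi>" and B: "open B" and supp: "\<And>x. x \<notin> A \<Longrightarrow> F x = 0"
  shows integrable_deformed:
      "integrable lebesgue (\<lambda>z. k (\<Phi> z) * deformed B \<Phi> F z) \<longleftrightarrow> integrable lebesgue (\<lambda>y. k y * F y)"
    and integral_deformed:
      "(LINT z | lebesgue. k (\<Phi> z) * deformed B \<Phi> F z) = (LINT y | lebesgue. k y * F y)"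
proof -
  have der: "(\<Phi> has_derivative frechet_derivative \<Phi> (at x)) (at x within B)" if "x \<in> B" for x
    using \<Phi> that by (auto simp: deformation_def C1_on_def frechet_derivative_works intro: has_derivative_at_withinI)
  have inj: "inj_on \<Phi> B" and im: "\<Phi> ` B = A"
    using \<Phi> by (auto simp: deformation_def bij_betw_def)
  have lhs: "indicator B z *\<^sub>R (\<bar>det (matrix (frechet_derivative \<Phi> (at z)))\<bar> * (k (\<Phi> z) * F (\<Phi> z)))
      = k (\<Phi> z) * deformed B \<Phi> F z" for z
    by (simp add: deformed_def jacobian_def indicator_def)
  have rhs: "indicator A y *\<^sub>R (k y * F y) = k y * F y" for y
    using supp[of y] by (auto simp: indicator_def)
  have Bm: "B \<in> sets lebesgue"
    using B by simp
  show "integrable lebesgue (\<lambda>z. k (\<Phi> z) * deformed B \<Phi> F z) \<longleftrightarrow> integrable lebesgue (\<lambda>y. k y * F y)"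
    using set_integrable_change_of_variables[OF Bm der inj, of "\<lambda>y. k y * F y"]
    unfolding set_integrable_def lhs im rhs .
  show "(LINT z | lebesgue. k (\<Phi> z) * deformed B \<Phi> F z) = (LINT y | lebesgue. k y * F y)"
    using set_integral_change_of_variables[OF Bm der inj, of "\<lambda>y. k y * F y"]
    unfolding set_lebesgue_integral_def lhs im rhs .
qed

text \<open>The inverse is continuous by invariance of domain.\<close>

lemma deformation_continuous:
  fixes \<Phi> :: "real ^ 'n::finite \<Rightarrow> real ^ 'n"
  assumes \<Phi>: "deformation \<epsilon> B A \<Phi>" and B: "open B"
  shows "continuous_on B \<Phi>" "continuous_on A (inv_into B \<Phi>)"
proof -
  show 1: "continuous_on B \<Phi>"
    using \<Phi> by (intro continuous_at_imp_continuous_on ballI differentiable_imp_continuous_within)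
      (auto simp: deformation_def C1_on_def)
  have "inj_on \<Phi> B" "\<Phi> ` B = A"
    using \<Phi> by (auto simp: deformation_def bij_betw_def)
  then show "continuous_on A (inv_into B \<Phi>)"
    using continuous_on_inverse_open[OF B 1, of "inv_into B \<Phi>"] by auto
qed

text \<open>
  Both projections vanish outside a bounded interval and have the same total mass, so the norm may be computed on the whole line,
  where the primitive is a difference of half-space integrals.
\<close>

lemma volterra_norm_projection_difference:
  fixes w :: "real ^ 'n::finite" and F G :: "real ^ 'n \<Rightarrow> real"
  assumes w: "norm w = 1" and F: "integrable lebesgue F" and G: "integrable lebesgue G"
    and supp: "\<And>y. norm y > R \<Longrightarrow> F y = 0" "\<And>y. norm y > R \<Longrightarrow> G y = 0"
    and mass: "(LINT y | lebesgue. F y) = (LINT y | lebesgue. G y)" and p: "1 \<le> p"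
  shows "volterra_norm p (\<lambda>t. tomographic_projection w F t - tomographic_projection w G t)
    = Lp_norm lebesgue p (\<lambda>x. halfspace_integral F w x - halfspace_integral G w x)"
proof -
  let ?h = "\<lambda>t. tomographic_projection w F t - tomographic_projection w G t"
  note fubini = tomographic_projection_Fubini[OF w F] tomographic_projection_Fubini[OF w G]
  have out: "?h t = 0" if "\<bar>R\<bar> < \<bar>t\<bar>" for t
  proof -
    have "R < norm y" if "y \<bullet> w = t" for y
      using Cauchy_Schwarz_ineq2[of y w] w that \<open>\<bar>R\<bar> < \<bar>t\<bar>\<close> by simp
    then have "tomographic_projection w F t = 0" "tomographic_projection w G t = 0"
      using supp by (blast intro: tomographic_projection_eq_0[OF w])+
    then show ?thesis by simp
  qed
  have I: "supporting_interval ?h (- \<bar>R\<bar>, \<bar>R\<bar>)"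
    unfolding supporting_interval_def
  proof (intro case_prodI conjI allI impI)
    fix t assume "t \<notin> {- \<bar>R\<bar>..\<bar>R\<bar>}"
    then show "?h t = 0"
      by (intro out) auto
  qed simp
  have "(LINT t | lebesgue. ?h t) = (LINT y | lebesgue. F y) - (LINT y | lebesgue. G y)"
    using fubini[where k = "\<lambda>t. 1"] by simp
  then have 0: "(LINT t | lebesgue. ?h t) = 0"
    using mass by simp
  have "(LINT t : {..x} | lebesgue. ?h t) = halfspace_integral F w x - halfspace_integral G w x" for x
  proof -
    have "(LINT t : {..x} | lebesgue. ?h t)
      = (LINT t | lebesgue. indicator {..x} t * tomographic_projection w F t - indicator {..x} t * tomographic_projection w G t)"
      by (simp add: set_lebesgue_integral_def right_diff_distrib)
    also have "\<dots> = halfspace_integral F w x - halfspace_integral G w x"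
      unfolding halfspace_integral_def
      using fubini[where k = "indicator {..x}"] by (subst Bochner_Integration.integral_diff) (simp_all add: indicator_def)
    finally show ?thesis .
  qed
  then show ?thesis
    using volterra_norm_eq[OF I 0 p] volterra_norm_on_eq[OF I 0 p] by simp
qed

lemma measurable_extend_by_id:
  fixes f :: "'a::euclidean_space \<Rightarrow> 'a"
  assumes "open S" "continuous_on S f"
  shows "(\<lambda>x. if x \<in> S then f x else x) \<in> borel \<rightarrow>\<^sub>M borel"
  using assms by (intro borel_measurable_continuous_on_if continuous_on_id) auto

text \<open>
  The difference of half-space integrals has two descriptions: as an integral against \<open>F\<close>, where points are displaced by the
  inverse of the deformation, and as an integral against the deformed density, where they are displaced by the
  deformation itself. The crossing estimates apply to each, which gives the minimum of the two norms.
\<close>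

lemma Lp_norm_halfspace_deformed_le:
  fixes w :: "real ^ 'n::finite"
  assumes w: "norm w = 1" and A: "bounded A" "open A" and B: "bounded B" "open B"
    and diam: "\<And>y z. y \<in> A \<union> B \<Longrightarrow> z \<in> A \<union> B \<Longrightarrow> norm (y - z) \<le> r" and r: "0 < r"
    and p: "1 \<le> p" and F: "integrable lebesgue F" and supp: "\<And>x. x \<notin> A \<Longrightarrow> F x = 0"
    and \<epsilon>: "0 < \<epsilon>" and \<Phi>: "deformation \<epsilon> B A \<Phi>"
  defines "D \<equiv> \<lambda>x. halfspace_integral F w x - halfspace_integral (deformed B \<Phi> F) w x"
  shows "Lp_norm lebesgue p D \<le> ennreal \<epsilon> * K_const p B \<Phi> F * ennreal (C_const p CARD('n) r)"
    "Lp_norm lebesgue p D \<le> ennreal (\<epsilon> powr recip_exponent p) * Lp_norm lebesgue 1 F"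
proof -
  let ?FD = "deformed B \<Phi> F"
  define \<Psi> where "\<Psi> = inv_into B \<Phi>"
  have bij: "bij_betw \<Phi> B A"
    using \<Phi> by (simp add: deformation_def)
  have \<Psi>\<Phi>: "\<Psi> (\<Phi> z) = z" if "z \<in> B" for z
    unfolding \<Psi>_def using bij that by (rule bij_betw_inv_into_left)
  have \<Phi>\<Psi>: "\<Phi> (\<Psi> y) = y" "\<Psi> y \<in> B" if "y \<in> A" for y
    unfolding \<Psi>_def using bij that by (auto simp: bij_betw_inv_into_right bij_betw_def inv_into_into)
  have close: "norm (z - \<Phi> z) \<le> \<epsilon>" if "z \<in> B" for z
    using \<Phi> that by (simp add: deformation_def)
  have FD_off: "?FD z = 0" if "z \<notin> B" for z
    using that by (simp add: deformed_def)
  note cov = integrable_deformed[where F = F, OF \<Phi> B(2) supp] integral_deformed[where F = F, OF \<Phi> B(2) supp]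
  have FD: "integrable lebesgue ?FD"
    using cov(1)[where k = "\<lambda>_. 1"] F by simp
  \<comment> \<open>Borel maps on the whole space that agree with \<open>\<Phi>\<close> and its inverse where the densities live\<close>
  let ?S = "\<lambda>z. if z \<in> B then \<Phi> z else z" and ?T = "\<lambda>y. if y \<in> A then \<Psi> y else y"
  have S: "?S \<in> borel \<rightarrow>\<^sub>M borel"
    by (intro measurable_extend_by_id B deformation_continuous(1)[OF \<Phi>])
  have T: "?T \<in> borel \<rightarrow>\<^sub>M borel"
    unfolding \<Psi>_def by (intro measurable_extend_by_id A deformation_continuous(2)[OF \<Phi>] B)
  have D [measurable]: "D \<in> borel_measurable borel"
  proof -
    have [measurable]: "(\<lambda>x. halfspace_integral f w x) \<in> borel_measurable borel"
      if "integrable lebesgue f" for f :: "real ^ 'n \<Rightarrow> real"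
      using measurable_Pair2[OF measurable_halfspace_integral[OF borel_measurable_integrable[OF that]], of w]
      by simp
    show ?thesis
      unfolding D_def using F FD by measurable
  qed
  \<comment> \<open>the half-space integral of the deformed density is pulled back to an integral against \<open>F\<close>\<close>
  have D_F: "ennreal \<bar>D x\<bar> \<le> (\<integral>\<^sup>+y. ennreal \<bar>F y\<bar> * indicator (crossing w ?T x) y \<partial>lebesgue)" for x
  proof -
    have eq: "indicator {..x} (\<Psi> (\<Phi> z) \<bullet> w) * ?FD z = indicator {..x} (z \<bullet> w) * ?FD z" for z
      by (cases "z \<in> B") (simp_all add: \<Psi>\<Phi> FD_off)
    have int: "integrable lebesgue (\<lambda>y. indicator {..x} (\<Psi> y \<bullet> w) * F y)"
      using cov(1)[where k = "\<lambda>y. indicator {..x} (\<Psi> y \<bullet> w)"] integrable_halfspace[OF FD, of x w] by (simp add: eq)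
    have eq': "halfspace_integral ?FD w x = (LINT y | lebesgue. indicator {..x} (\<Psi> y \<bullet> w) * F y)"
      using cov(2)[where k = "\<lambda>y. indicator {..x} (\<Psi> y \<bullet> w)"] by (simp add: eq halfspace_integral_def)
    have "\<Psi> y = ?T y" if "F y \<noteq> 0" for y
      using supp that by auto
    then show ?thesis
      unfolding D_def eq'
      by (rule halfspace_difference_le_crossing[OF integrable_halfspace[OF F] int])
  qed
  \<comment> \<open>the half-space integral of \<open>F\<close> is pushed forward to an integral against the deformed density\<close>
  have D_FD: "ennreal \<bar>D x\<bar> \<le> (\<integral>\<^sup>+z. ennreal \<bar>?FD z\<bar> * indicator (crossing w ?S x) z \<partial>lebesgue)" for x
  proof -
    have int: "integrable lebesgue (\<lambda>z. indicator {..x} (\<Phi> z \<bullet> w) * ?FD z)"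
      using cov(1)[where k = "\<lambda>y. indicator {..x} (y \<bullet> w)"] integrable_halfspace[OF F, of x w] by simp
    have eq: "halfspace_integral F w x = (LINT z | lebesgue. indicator {..x} (\<Phi> z \<bullet> w) * ?FD z)"
      using cov(2)[where k = "\<lambda>y. indicator {..x} (y \<bullet> w)"] by (simp add: halfspace_integral_def)
    have "\<Phi> z = ?S z" if "?FD z \<noteq> 0" for z
      using FD_off that by auto
    then show ?thesis
      unfolding D_def abs_minus_commute[of "halfspace_integral F w x"] unfolding eq
      by (rule halfspace_difference_le_crossing[OF integrable_halfspace[OF FD] int])
  qed
  have closeT: "norm (y - ?T y) \<le> \<epsilon>" if "y \<in> A" for y
    using close[OF \<Phi>\<Psi>(2)[OF that]] that by (simp add: \<Phi>\<Psi> norm_minus_commute)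
  have closeS: "norm (z - ?S z) \<le> \<epsilon>" if "z \<in> B" for z
    using close that by simp
  note bF = Lp_halfspace_difference_le[OF w T borel_measurable_integrable[OF F] _ A(1) _ r closeT \<epsilon> supp p D D_F]
  note bFD = Lp_halfspace_difference_le[OF w S borel_measurable_integrable[OF FD] _ B(1) _ r closeS \<epsilon> FD_off p D D_FD]
  have "Lp_norm lebesgue p D \<le> ennreal \<epsilon> * Lp_norm lebesgue p F * ennreal (C_const p CARD('n) r)"
    using A by (intro bF(1) diam) auto
  moreover have "Lp_norm lebesgue p D \<le> ennreal \<epsilon> * Lp_norm lebesgue p ?FD * ennreal (C_const p CARD('n) r)"
    using B by (intro bFD(1) diam) auto
  ultimately show "Lp_norm lebesgue p D \<le> ennreal \<epsilon> * K_const p B \<Phi> F * ennreal (C_const p CARD('n) r)"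
    by (simp add: K_const_def min_def)
  show "Lp_norm lebesgue p D \<le> ennreal (\<epsilon> powr recip_exponent p) * Lp_norm lebesgue 1 F"
    using A by (intro bF(2) diam) auto
qed

section \<open>The sliced Volterra distance between a density and its deformation\<close>

theorem theorem4p4:
  fixes A B :: "(real ^ 'n) set"
    and F :: "real ^ 'n \<Rightarrow> real"
    and \<Phi> :: "real ^ 'n \<Rightarrow> real ^ 'n"
    and \<eta> :: "(real ^ 'n) measure"
    and p :: ennreal
    and \<epsilon> r :: real
  assumes "A \<noteq> {}" "bounded A" "open A"
    and "B \<noteq> {}" "bounded B" "open B"
    and "r = diameter (A \<union> B)"
    and "1 \<le> p"
    and "in_Lp lebesgue p F"
    and "\<forall>x. x \<notin> A \<longrightarrow> F x = 0"
    and "\<epsilon> > 0"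
    and "deformation \<epsilon> B A \<Phi>"
    and "prob_space \<eta>"
    and "sets \<eta> = sets (restrict_space borel (sphere 0 1))"
  shows "sliced_volterra p \<eta> F (deformed B \<Phi> F) \<le>
      min (ennreal \<epsilon> * K_const p B \<Phi> F * ennreal (C_const p CARD('n) r))
          (ennreal (\<epsilon> powr recip_exponent p) * Lp_norm lebesgue 1 F)"
proof -
  note A = assms(2,3) and B = assms(5,6) and p = assms(8) and \<epsilon> = assms(11) and \<Phi> = assms(12)
  have supp: "F x = 0" if "x \<notin> A" for x
    using assms(10) that by blast
  let ?FD = "deformed B \<Phi> F"
  have diam: "norm (y - z) \<le> r" if "y \<in> A \<union> B" "z \<in> A \<union> B" for y z
    using diameter_bounded_bound[of "A \<union> B" y z] that A B by (simp add: assms(7) dist_norm)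
  \<comment> \<open>positivity matters for \<open>d = 1\<close> and for \<open>p = 1\<close>, where the constant contains \<open>r powr 0\<close> and \<open>0 powr 0 = 0\<close>\<close>
  have r: "0 < r"
  proof -
    obtain a e where a: "a \<in> A" and e: "0 < e" "ball a e \<subseteq> A"
      using assms(1) A(2) by (meson ex_in_conv open_contains_ball)
    obtain v :: "real ^ 'n" where v: "norm v = e / 2"
      using e by (metis vector_choose_size half_gt_zero less_imp_le)
    then have "a + v \<in> A"
      using e by (intro subsetD[OF e(2)]) (simp add: dist_norm)
    then have "norm (a + v - a) \<le> r"
      using a by (intro diam) auto
    then show ?thesis
      using v e by simp
  qed
  have F: "integrable lebesgue F"
    using integrable_of_in_Lp_bounded_support[OF p assms(9) A supp] .
  note cov = integrable_deformed[where F = F and k = "\<lambda>_. 1", OF \<Phi> B(2) supp]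
    integral_deformed[where F = F and k = "\<lambda>_. 1", OF \<Phi> B(2) supp]
  have FD: "integrable lebesgue ?FD" and mass: "(LINT y | lebesgue. F y) = (LINT z | lebesgue. ?FD z)"
    using F cov by simp_all
  obtain R where R: "\<And>y. y \<in> A \<union> B \<Longrightarrow> norm y \<le> R"
    using bounded_Un[of A B] A B by (metis bounded_iff)
  have offR: "F y = 0" "?FD y = 0" if "R < norm y" for y
    using R[of y] that supp by (auto simp: deformed_def)
  let ?D = "\<lambda>w x. halfspace_integral F w x - halfspace_integral ?FD w x"
  let ?v = "\<lambda>w. volterra_norm p (\<lambda>t. tomographic_projection w F t - tomographic_projection w ?FD t)"
  have sphere: "norm w = 1" if "w \<in> space \<eta>" for w
    using that sets_eq_imp_space_eq[OF assms(14)] by (simp add: space_restrict_space)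
  have v: "?v w = Lp_norm lebesgue p (?D w)" if "w \<in> space \<eta>" for w
    using volterra_norm_projection_difference[OF sphere[OF that] F FD offR mass p] .
  have bound: "?v w \<le> min (ennreal \<epsilon> * K_const p B \<Phi> F * ennreal (C_const p CARD('n) r))
      (ennreal (\<epsilon> powr recip_exponent p) * Lp_norm lebesgue 1 F)" if "w \<in> space \<eta>" for w
    unfolding v[OF that]
    using Lp_norm_halfspace_deformed_le[OF sphere[OF that] A B diam r p F supp \<epsilon> \<Phi>] by simp
  \<comment> \<open>the hypothesis for \<open>p = \<infinity>\<close> of the bound for an average over a probability space\<close>
  have meas: "?v \<in> borel_measurable \<eta>" if "p = \<infinity>"
  proof -
    have [measurable]: "(\<lambda>(w, x). halfspace_integral F w x) \<in> borel_measurable (borel \<Otimes>\<^sub>M borel)"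
      "(\<lambda>(w, x). halfspace_integral ?FD w x) \<in> borel_measurable (borel \<Otimes>\<^sub>M borel)"
      using F FD by (simp_all only: measurable_halfspace_integral borel_measurable_integrable)
    have D [measurable]: "(\<lambda>(w, x). ennreal \<bar>?D w x\<bar>) \<in> borel_measurable (borel \<Otimes>\<^sub>M borel)"
      by measurable
    then have "(\<lambda>w. esssup lborel (\<lambda>x. ennreal \<bar>?D w x\<bar>)) \<in> borel_measurable borel"
      by (intro measurable_esssup lborel.sigma_finite_measure_axioms) simp
    then have "(\<lambda>w. esssup lborel (\<lambda>x. ennreal \<bar>?D w x\<bar>)) \<in> borel_measurable \<eta>"
      unfolding measurable_cong_sets[OF assms(14) refl] by (rule measurable_restrict_space1)
    moreover have "?v w = esssup lborel (\<lambda>x. ennreal \<bar>?D w x\<bar>)" if "w \<in> space \<eta>" for w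
    proof -
      have "(\<lambda>x. ennreal \<bar>?D w x\<bar>) \<in> borel_measurable lborel"
        using measurable_Pair2[OF D, of w] by simp
      then show ?thesis
        unfolding v[OF that] using \<open>p = \<infinity>\<close> by (simp add: Lp_norm_def Lp_ennorm_def esssup_completion)
    qed
    ultimately show ?thesis
      by (simp cong: measurable_cong)
  qed
  show ?thesis
    unfolding sliced_volterra_def using assms(13) p meas bound by (rule Lp_ennorm_const_bound)
qed

end
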